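(* In the discrete-time setting described in the context, let $\mathcal U\subseteq\prod_{k=0}^{N-1}(L^2_{\mathcal F_k})^m$ be nonempty and closed, and suppose $(\bar x,\bar u)$ is a local solution of $$\min\ \mathbb E\Big(\sum_{k=0}^{N-1}\ell(k,x_k,u_k)+\Phi(x_N)\Big)\ \text{s.t. } x_{k+1}=b(k,x_k,u_k)+\sigma(k,x_k,u_k)w_{k+1}\ (k=0,\dots,N-1),\ x_0=\hat x_0,\ x\in\prod_{k=0}^NX_k,\ u\in\mathcal U.$$ Then there exist $p\in\prod_{k=0}^{N-1}(L^2_{\mathcal F_k})^n$ and $q\in\prod_{k=0}^{N-1}(L^2_{\mathcal F_k})^{n\times d}$ such that $$p_{k-1}=\mathbb E\big(\nabla_xH(k,\bar x_k,p_k,q_k,\bar u_k)\,|\,\mathcal F_{k-1}\big),\quad q^i_{k-1}=\mathbb E\big(\nabla_xH(k,\bar x_k,p_k,q_k,\bar u_k)w_k^i\,|\,\mathcal F_{k-1}\big)$$ for all $k\in\{1,\dots,N-1\}$ and $i\in\{1,\dots,d\}$, $$p_{N-1}=\mathbb E(\nabla\Phi(\bar x_N)|\mathcal F_{N-1}),\quad q^i_{N-1}=\mathbb E(\nabla\Phi(\bar x_N)w_N^i|\mathcal F_{N-1})\ \ (i=1,\dots,d),$$ and $$\mathbb E\Big(\sum_{k=0}^{N-1}\nabla_uH(k,\bar x_k,p_k,q_k,\bar u_k)\cdot v_k\Big)\ge0\quad\forall v\in T_{\mathcal U}(\bar u).$$ If in addition $K(\mathcal U,\bar u)$ is convex, the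 last inequality holds for all $v\in K(\mathcal U,\bar u)$.
   Context: $(\Omega,\mathcal F,\mathbb P)$ is a probability space; $w_1,\dots,w_N$ are independent $\mathbb R^d$-valued random variables with independent coordinates, $\mathbb E(w_k^i)=0$, $\mathbb E|w_k^i|^2=1$; $w_0:=0$, $\mathcal F_k=\sigma(w_0,\dots,w_k)$, $L^2_{\mathcal F_k}$ the $\mathcal F_k$-measurable square-integrable random variables. $X_0=\mathbb R^n$ and $X_k=\{y^0+\sum_{i=1}^dy^iw_k^i:y^i\in(L^2_{\mathcal F_{k-1}})^n\}$ for $k\ge1$, normed by $\|x\|_{X_k}^2=\mathbb E|x|^2$; products carry sums of norms; local solution means minimal cost among feasible pairs in a neighbourhood in $\prod_kX_k\times\prod_k(L^2_{\mathcal F_k})^m$. $\hat x_0\in\mathbb R^n$. Data $b:\{0,\dots,N-1\}\times\mathbb R^n\times\mathbb R^m\to\mathbb R^n$, $\sigma:\ldots\to\mathbb R^{n\times d}$ (columns $\sigma^i$), $\ell:\{0,\dots,N-1\}\times\mathbb R^n\times\mathbb R^m\to\mathbb R$, $\Phi:\mathbb R^n\to\mathbb R$ are Borel measurable and $C^1$ in $(x,u)$ (resp. $x$), with $c_1,c_2>0$ such that for $\psi\in\{b,\sigma^i\}$: $|\psi(k,x,u)|\le c_1(1+|x|+|u|)$, $|\psi_x|+|\psi_u|\le c_1$; and $|\ell|\le c_2(1+|x|+|u|)^2$, $|\ell_x|+|\ell_u|\le c_2(1+|x|+|u|)$, $|\Phi(x)|\le c_2(1+|x|)^2$, $|\Phi_x|\le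 c_2(1+|x|)$. Hamiltonian $H(k,x,p,q,u)=\ell(k,x,u)+p\cdot b(k,x,u)+\sum_{i=1}^dq^i\cdot\sigma^i(k,x,u)$, $q^i$ the $i$-th column of $q$. In the Hilbert space $\prod_k(L^2_{\mathcal F_k})^m$: $T_{\mathcal U}(\bar u)=\{v:\lim_{w\to\bar u,\,w\in\mathcal U,\,\tau\to0^+}d_{\mathcal U}(w+\tau v)/\tau=0\}$ (Clarke tangent cone), $K(\mathcal U,\bar u)=\{v:\liminf_{\tau\to0^+}d_{\mathcal U}(\bar u+\tau v)/\tau=0\}$ (contingent cone). *)

theory Defs
  imports "HOL-Analysis.Analysis" "HOL-Probability.Probability"
begin

definition C1_map :: "('a::real_normed_vector \<Rightarrow> 'b::real_normed_vector) \<Rightarrow> bool" where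
  "C1_map f \<longleftrightarrow> (\<exists>D. (\<forall>z. (f has_derivative blinfun_apply (D z)) (at z)) \<and> continuous_on UNIV D)"

definition Dx :: "('x::real_normed_vector \<Rightarrow> 'u \<Rightarrow> 'b::real_normed_vector) \<Rightarrow> 'x \<Rightarrow> 'u \<Rightarrow> 'x \<Rightarrow> 'b" where
  "Dx f x u = frechet_derivative (\<lambda>x'. f x' u) (at x)"

definition Du :: "('x \<Rightarrow> 'u::real_normed_vector \<Rightarrow> 'b::real_normed_vector) \<Rightarrow> 'x \<Rightarrow> 'u \<Rightarrow> 'u \<Rightarrow> 'b" where
  "Du f x u = frechet_derivative (\<lambda>u'. f x u') (at u)"

definition grad :: "(real^'n \<Rightarrow> real) \<Rightarrow> real^'n \<Rightarrow> real^'n" where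
  "grad f x = (\<chi> j. frechet_derivative f (at x) (axis j 1))"

text \<open>\<open>\<sigma> k x u $ i\<close> is the i-th column \<open>\<sigma>\<^sup>i\<close> of the \<open>n\<times>d\<close> matrix; likewise \<open>q $ i\<close> is \<open>q\<^sup>i\<close>.\<close>
definition Ham ::
  "(nat \<Rightarrow> real^'n \<Rightarrow> real^'m \<Rightarrow> real) \<Rightarrow> (nat \<Rightarrow> real^'n \<Rightarrow> real^'m \<Rightarrow> real^'n)
   \<Rightarrow> (nat \<Rightarrow> real^'n \<Rightarrow> real^'m \<Rightarrow> real^'n^'d::finite)
   \<Rightarrow> nat \<Rightarrow> real^'n \<Rightarrow> real^'n \<Rightarrow> real^'n^'d \<Rightarrow> real^'m \<Rightarrow> real" where
  "Ham ell b \<sigma> k x p q u = ell k x u + p \<bullet> b k x u + (\<Sum>i\<in>UNIV. (q $ i) \<bullet> (\<sigma> k x u $ i))"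

definition gradx_Ham where
  "gradx_Ham ell b \<sigma> k x p q u = grad (\<lambda>x'. Ham ell b \<sigma> k x' p q u) x"

definition gradu_Ham where
  "gradu_Ham ell b \<sigma> k x p q u = grad (\<lambda>u'. Ham ell b \<sigma> k x p q u') u"

text \<open>\<open>\<F>\<^sub>k = \<sigma>(w\<^sub>0,\<dots>,w\<^sub>k)\<close> with \<open>w\<^sub>0 = 0\<close>, i.e. generated by \<open>w\<^sub>1,\<dots>,w\<^sub>k\<close>
  (for \<open>k = 0\<close> the trivial sigma algebra).\<close>
definition filt :: "'a measure \<Rightarrow> (nat \<Rightarrow> 'a \<Rightarrow> real^'d) \<Rightarrow> nat \<Rightarrow> 'a measure" where
  "filt M w k = sigma (space M) {w j -` A \<inter> space M | j A. j \<in> {1..k} \<and> A \<in> sets borel}"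

definition L2 :: "'a measure \<Rightarrow> 'a measure \<Rightarrow> ('a \<Rightarrow> 'b::euclidean_space) \<Rightarrow> bool" where
  "L2 M F f \<longleftrightarrow> f \<in> borel_measurable F \<and> integrable M (\<lambda>\<omega>. (norm (f \<omega>))\<^sup>2)"

definition L2norm :: "'a measure \<Rightarrow> ('a \<Rightarrow> 'b::euclidean_space) \<Rightarrow> real" where
  "L2norm M f = sqrt (\<integral>\<omega>. (norm (f \<omega>))\<^sup>2 \<partial>M)"

definition cond_exp_vec :: "'a measure \<Rightarrow> 'a measure \<Rightarrow> ('a \<Rightarrow> real^'n) \<Rightarrow> 'a \<Rightarrow> real^'n" where
  "cond_exp_vec M F f = (\<lambda>\<omega>. \<chi> j. real_cond_exp M F (\<lambda>\<omega>'. f \<omega>' $ j) \<omega>)"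

definition Xsp :: "'a measure \<Rightarrow> (nat \<Rightarrow> 'a \<Rightarrow> real^'d::finite) \<Rightarrow> nat \<Rightarrow> ('a \<Rightarrow> real^'n) set" where
  "Xsp M w k = {x. x \<in> borel_measurable M \<and>
     (if k = 0 then (\<exists>c. AE \<omega> in M. x \<omega> = c)
      else (\<exists>y0 y. L2 M (filt M w (k-1)) y0 \<and> (\<forall>i. L2 M (filt M w (k-1)) (y i)) \<and>
               (AE \<omega> in M. x \<omega> = y0 \<omega> + (\<Sum>i\<in>UNIV. (w k \<omega> $ i) *\<^sub>R y i \<omega>))))}"

text \<open>Elements of the control space \<open>\<Prod>\<^sub>k<N (L\<^sup>2\<^sub>F\<^sub>k)\<^sup>m\<close> (represented by functions;
  only indices \<open>k < N\<close> matter).\<close>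
definition adm :: "'a measure \<Rightarrow> (nat \<Rightarrow> 'a \<Rightarrow> real^'d) \<Rightarrow> nat \<Rightarrow> (nat \<Rightarrow> 'a \<Rightarrow> real^'m) \<Rightarrow> bool" where
  "adm M w N u \<longleftrightarrow> (\<forall>k<N. L2 M (filt M w k) (u k))"

definition cdist :: "'a measure \<Rightarrow> nat \<Rightarrow> (nat \<Rightarrow> 'a \<Rightarrow> real^'m) \<Rightarrow> (nat \<Rightarrow> 'a \<Rightarrow> real^'m) \<Rightarrow> real" where
  "cdist M N u v = (\<Sum>k<N. L2norm M (\<lambda>\<omega>. u k \<omega> - v k \<omega>))"

definition distU where
  "distU M N U z = Inf {cdist M N z u | u. u \<in> U}"

text \<open>A subset of the Hilbert space, represented as a set of representatives: it consists of
  admissible elements and is saturated under a.e. equality (i.e. it is a set of classes).\<close>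
definition ctrl_set where
  "ctrl_set M w N U \<longleftrightarrow> (\<forall>u\<in>U. adm M w N u) \<and>
     (\<forall>u\<in>U. \<forall>v. adm M w N v \<and> (\<forall>k<N. AE \<omega> in M. v k \<omega> = u k \<omega>) \<longrightarrow> v \<in> U)"

definition closed_ctrl where
  "closed_ctrl M w N U \<longleftrightarrow> (\<forall>s u. (\<forall>j. s j \<in> U) \<and> adm M w N u \<and>
       (\<lambda>j. cdist M N (s j) u) \<longlonglongrightarrow> 0 \<longrightarrow> u \<in> U)"

definition addc :: "(nat \<Rightarrow> 'a \<Rightarrow> real^'m) \<Rightarrow> real \<Rightarrow> (nat \<Rightarrow> 'a \<Rightarrow> real^'m) \<Rightarrow> nat \<Rightarrow> 'a \<Rightarrow> real^'m" where
  "addc u t v = (\<lambda>k \<omega>. u k \<omega> + t *\<^sub>R v k \<omega>)"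

definition clarke_cone where
  "clarke_cone M w N U ub = {v. adm M w N v \<and>
     (\<forall>\<epsilon>>0. \<exists>\<delta>>0. \<forall>z\<in>U. \<forall>\<tau>. cdist M N z ub < \<delta> \<and> 0 < \<tau> \<and> \<tau> < \<delta> \<longrightarrow>
        \<bar>distU M N U (addc z \<tau> v) / \<tau>\<bar> < \<epsilon>)}"

definition contingent_cone where
  "contingent_cone M w N U ub = {v. adm M w N v \<and>
     Liminf (at_right 0) (\<lambda>\<tau>. ereal (distU M N U (addc ub \<tau> v) / \<tau>)) = 0}"

definition convex_ctrl where
  "convex_ctrl K \<longleftrightarrow> (\<forall>v1\<in>K. \<forall>v2\<in>K. \<forall>t::real. 0 \<le> t \<and> t \<le> 1 \<longrightarrow>
      (\<lambda>k \<omega>. (1 - t) *\<^sub>R v1 k \<omega> + t *\<^sub>R v2 k \<omega>) \<in> K)"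

definition cost where
  "cost M N ell \<Phi> x u = (\<integral>\<omega>. (\<Sum>k<N. ell k (x k \<omega>) (u k \<omega>)) + \<Phi> (x N \<omega>) \<partial>M)"

definition feasible where
  "feasible M w N b \<sigma> x0 U x u \<longleftrightarrow>
     (\<forall>k\<le>N. x k \<in> Xsp M w k) \<and> u \<in> U \<and>
     (AE \<omega> in M. x 0 \<omega> = x0) \<and>
     (\<forall>k<N. AE \<omega> in M. x (Suc k) \<omega> =
          b k (x k \<omega>) (u k \<omega>) + (\<Sum>i\<in>UNIV. (w (Suc k) \<omega> $ i) *\<^sub>R (\<sigma> k (x k \<omega>) (u k \<omega>) $ i)))"

definition local_solution where
  "local_solution M w N b \<sigma> ell \<Phi> x0 U xb ub \<longleftrightarrow>
     feasible M w N b \<sigma> x0 U xb ub \<and>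
     (\<exists>\<epsilon>>0. \<forall>x u. feasible M w N b \<sigma> x0 U x u \<and>
        (\<Sum>k\<le>N. L2norm M (\<lambda>\<omega>. x k \<omega> - xb k \<omega>)) + cdist M N u ub < \<epsilon> \<longrightarrow>
        cost M N ell \<Phi> xb ub \<le> cost M N ell \<Phi> x u)"

end

theory Submission
  imports Defs
begin

text \<open>
  A control determines its trajectory, so the problem is the minimisation of a cost that depends on
  the control alone. This cost has directional derivatives along every sequence of controls whose
  difference quotients converge in \<open>L2\<close>: since the coefficients are Lipschitz and the noise has
  conditional variance \<open>1\<close>, the difference quotients of the trajectories converge in \<open>L2\<close> to the
  solution of the linearised equation. Contingent vectors are limits of difference quotients of
  controls in \<open>U\<close>, and Clarke tangent vectors are contingent, so the derivative is nonnegative in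
  these directions. The costate is the backward conditional expectation of the gradient of the
  Hamiltonian; pairing it with the linearised trajectory and summing by parts turns the derivative
  into the integral of \<open>\<nabla>\<^sub>uH \<bullet> v\<close>.
\<close>

section \<open>Square integrable functions\<close>

lemma L2_measurable: "L2 M F f \<Longrightarrow> f \<in> borel_measurable F"
  by (simp add: L2_def)

lemma L2_integrable_norm_sq: "L2 M F f \<Longrightarrow> integrable M (\<lambda>\<omega>. (norm (f \<omega>))\<^sup>2)"
  by (simp add: L2_def)

lemma subalgebra_refl: "subalgebra M M"
  by (simp add: subalgebra_def)

lemma L2_subalgebra: "subalgebra G F \<Longrightarrow> L2 M F f \<Longrightarrow> L2 M G f"
  by (auto simp: L2_def measurable_from_subalg)

lemma L2_dominated:
  fixes f :: "'a \<Rightarrow> 'b::euclidean_space" and g :: "'a \<Rightarrow> 'c::euclidean_space"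
  assumes F: "subalgebra M F" and f: "f \<in> borel_measurable F" and g: "L2 M M g"
    and norm_le: "\<And>\<omega>. norm (f \<omega>) \<le> norm (g \<omega>)"
  shows "L2 M F f"
proof -
  have [measurable]: "f \<in> borel_measurable M"
    using measurable_from_subalg[OF F f] .
  have "integrable M (\<lambda>\<omega>. (norm (f \<omega>))\<^sup>2)"
    by (rule Bochner_Integration.integrable_bound[OF L2_integrable_norm_sq[OF g]])
      (auto intro!: AE_I2 power_mono norm_le)
  with f show ?thesis by (simp add: L2_def)
qed

lemma L2_cong_AE:
  assumes f: "L2 M M f" and AE_eq: "AE \<omega> in M. g \<omega> = f \<omega>" and [measurable]: "g \<in> borel_measurable M"
  shows "L2 M M g"
proof -
  have [measurable]: "f \<in> borel_measurable M" using f by (rule L2_measurable)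
  have "integrable M (\<lambda>\<omega>. (norm (g \<omega>))\<^sup>2) \<longleftrightarrow> integrable M (\<lambda>\<omega>. (norm (f \<omega>))\<^sup>2)"
    by (rule integrable_cong_AE) (use AE_eq in auto)
  with f show ?thesis by (simp add: L2_def)
qed

lemma L2_const: "finite_measure M \<Longrightarrow> L2 M F (\<lambda>\<omega>. c)"
  by (simp add: L2_def finite_measure.integrable_const)

lemma L2_norm: "L2 M F f \<Longrightarrow> L2 M F (\<lambda>\<omega>. norm (f \<omega>))"
  by (auto simp: L2_def)

lemma L2_scaleR: "L2 M F f \<Longrightarrow> L2 M F (\<lambda>\<omega>. c *\<^sub>R f \<omega>)"
  by (auto simp: L2_def power_mult_distrib)

lemma L2_mult_left: "L2 M F f \<Longrightarrow> L2 M F (\<lambda>\<omega>. c * f \<omega>)" for f :: "'a \<Rightarrow> real"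
  using L2_scaleR[of M F f c] by simp

lemma L2_bounded_linear:
  fixes T :: "'b::euclidean_space \<Rightarrow> 'c::euclidean_space"
  assumes F: "subalgebra M F" and T: "bounded_linear T" and f: "L2 M F f"
  shows "L2 M F (\<lambda>\<omega>. T (f \<omega>))"
proof (rule L2_dominated[OF F])
  have "T \<in> borel_measurable borel"
    using T by (intro borel_measurable_continuous_onI linear_continuous_on)
  with L2_measurable[OF f] show "(\<lambda>\<omega>. T (f \<omega>)) \<in> borel_measurable F" by measurable
  show "L2 M M (\<lambda>\<omega>. onorm T *\<^sub>R f \<omega>)"
    by (intro L2_scaleR L2_subalgebra[OF F f])
  show "norm (T (f \<omega>)) \<le> norm (onorm T *\<^sub>R f \<omega>)" for \<omega>
    using onorm[OF T] onorm_pos_le[OF T] by simp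
qed

lemma norm_add_sq_le:
  fixes x y :: "'b::real_normed_vector"
  shows "(norm (x + y))\<^sup>2 \<le> 2 * (norm x)\<^sup>2 + 2 * (norm y)\<^sup>2"
proof -
  have "(norm (x + y))\<^sup>2 \<le> (norm x + norm y)\<^sup>2"
    by (intro power_mono norm_triangle_ineq) auto
  also have "\<dots> \<le> 2 * (norm x)\<^sup>2 + 2 * (norm y)\<^sup>2"
    using sum_squares_bound[of "norm x" "norm y"] by (simp add: power2_sum)
  finally show ?thesis .
qed

lemma L2_add:
  assumes F: "subalgebra M F" and f: "L2 M F f" and g: "L2 M F g"
  shows "L2 M F (\<lambda>\<omega>. f \<omega> + g \<omega>)"
proof -
  have [measurable]: "f \<in> borel_measurable F" "g \<in> borel_measurable F"
    using f g by (auto simp: L2_def)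
  have [measurable]: "f \<in> borel_measurable M" "g \<in> borel_measurable M"
    using measurable_from_subalg[OF F] L2_measurable f g by blast+
  have "integrable M (\<lambda>\<omega>. (norm (f \<omega> + g \<omega>))\<^sup>2)"
    by (rule Bochner_Integration.integrable_bound[where
          f="\<lambda>\<omega>. 2 * (norm (f \<omega>))\<^sup>2 + 2 * (norm (g \<omega>))\<^sup>2"])
      (use f g norm_add_sq_le in \<open>auto simp: L2_def\<close>)
  then show ?thesis by (simp add: L2_def)
qed

lemma L2_diff:
  assumes "subalgebra M F" "L2 M F f" "L2 M F g"
  shows "L2 M F (\<lambda>\<omega>. f \<omega> - g \<omega>)"
  using L2_add[OF assms(1,2) L2_scaleR[OF assms(3), of "-1"]] by simp

lemma L2_sum:
  assumes F: "subalgebra M F" and f: "\<And>i. i \<in> I \<Longrightarrow> L2 M F (f i)"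
  shows "L2 M F (\<lambda>\<omega>. \<Sum>i\<in>I. f i \<omega>)"
  using f
proof (induction I rule: infinite_finite_induct)
  case (insert i I)
  then show ?case by (simp add: L2_add[OF F])
qed (simp_all add: L2_def)

lemma L2_Pair:
  fixes f :: "'a \<Rightarrow> 'b::euclidean_space" and g :: "'a \<Rightarrow> 'c::euclidean_space"
  assumes "L2 M F f" "L2 M F g"
  shows "L2 M F (\<lambda>\<omega>. (f \<omega>, g \<omega>))"
  using assms by (auto simp: L2_def norm_Pair)

lemma L2_nth:
  fixes f :: "'a \<Rightarrow> 'b::euclidean_space^'d::finite"
  assumes "subalgebra M F" "L2 M F f"
  shows "L2 M F (\<lambda>\<omega>. f \<omega> $ i)"
  using L2_bounded_linear[OF assms(1) bounded_linear_vec_nth assms(2)] .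

lemma borel_measurable_vec_nth: "(\<lambda>v::real^'n. v $ i) \<in> borel_measurable borel"
  by (intro borel_measurable_continuous_onI continuous_intros)

lemma L2_componentwise:
  fixes f :: "'a \<Rightarrow> 'b::euclidean_space^'d::finite"
  assumes f: "\<And>i. L2 M F (\<lambda>\<omega>. f \<omega> $ i)"
  shows "L2 M F f"
proof -
  have "f \<in> borel_measurable F"
  proof (subst borel_measurable_euclidean_space, rule ballI)
    fix e :: "'b^'d" assume "e \<in> Basis"
    then obtain i u where "e = axis i u" by (auto simp: Basis_vec_def)
    then show "(\<lambda>\<omega>. f \<omega> \<bullet> e) \<in> borel_measurable F"
      using L2_measurable[OF f] by (simp add: inner_axis borel_measurable_inner)
  qed
  moreover have "(norm (f \<omega>))\<^sup>2 = (\<Sum>i\<in>UNIV. (norm (f \<omega> $ i))\<^sup>2)" for \<omega>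
    by (simp add: norm_vec_def L2_set_def sum_nonneg)
  ultimately show ?thesis using f by (simp add: L2_def)
qed

subsection \<open>The norm\<close>

lemma L2norm_nonneg: "0 \<le> L2norm M f"
  by (simp add: L2norm_def)

lemma L2norm_power2: "(L2norm M f)\<^sup>2 = (\<integral>\<omega>. (norm (f \<omega>))\<^sup>2 \<partial>M)"
  by (simp add: L2norm_def)

lemma L2norm_zero: "L2norm M (\<lambda>\<omega>. 0) = 0"
  by (simp add: L2norm_def)

lemma L2norm_scaleR: "L2norm M (\<lambda>\<omega>. c *\<^sub>R f \<omega>) = \<bar>c\<bar> * L2norm M f"
  by (simp add: L2norm_def power_mult_distrib real_sqrt_mult)

lemma L2norm_mono:
  assumes "L2 M M g" "\<And>\<omega>. norm (f \<omega>) \<le> norm (g \<omega>)"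
  shows "L2norm M f \<le> L2norm M g"
  unfolding L2norm_def using assms
  by (intro real_sqrt_le_mono integral_mono' power_mono) (auto simp: L2_def)

lemma L2norm_cong_AE:
  assumes [measurable]: "f \<in> borel_measurable M" "g \<in> borel_measurable M"
    and AE_eq: "AE \<omega> in M. f \<omega> = g \<omega>"
  shows "L2norm M f = L2norm M g"
proof -
  have "(\<integral>\<omega>. (norm (f \<omega>))\<^sup>2 \<partial>M) = (\<integral>\<omega>. (norm (g \<omega>))\<^sup>2 \<partial>M)"
    by (rule integral_cong_AE) (use AE_eq in auto)
  then show ?thesis by (simp add: L2norm_def)
qed

lemma nn_integral_norm_sq_eq_L2norm:
  assumes "L2 M M f"
  shows "(\<integral>\<^sup>+\<omega>. (ennreal (norm (f \<omega>)))\<^sup>2 \<partial>M) = ennreal ((L2norm M f)\<^sup>2)"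
  unfolding L2norm_power2 ennreal_power[OF norm_ge_zero]
  by (rule nn_integral_eq_integral[OF L2_integrable_norm_sq[OF assms]]) simp

lemma
  assumes f: "L2 M M f" and g: "L2 M M g"
  shows integrable_norm_mult_norm: "integrable M (\<lambda>\<omega>. norm (f \<omega>) * norm (g \<omega>))" (is ?integrable)
    and integral_norm_mult_norm_le: "(\<integral>\<omega>. norm (f \<omega>) * norm (g \<omega>) \<partial>M)
        \<le> L2norm M f * L2norm M g" (is ?le)
proof -
  have [measurable]: "f \<in> borel_measurable M" "g \<in> borel_measurable M"
    using f g by (auto simp: L2_def)
  let ?I = "\<integral>\<^sup>+\<omega>. ennreal (norm (f \<omega>) * norm (g \<omega>)) \<partial>M"
  have "?I\<^sup>2 = (\<integral>\<^sup>+\<omega>. ennreal (norm (f \<omega>)) * ennreal (norm (g \<omega>)) \<partial>M)\<^sup>2"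
    by (simp add: ennreal_mult)
  also have "\<dots> \<le> (\<integral>\<^sup>+\<omega>. (ennreal (norm (f \<omega>)))\<^sup>2 \<partial>M) * (\<integral>\<^sup>+\<omega>. (ennreal (norm (g \<omega>)))\<^sup>2 \<partial>M)"
    by (rule Cauchy_Schwarz_nn_integral) measurable
  also have "\<dots> = ennreal ((L2norm M f * L2norm M g)\<^sup>2)"
    unfolding nn_integral_norm_sq_eq_L2norm[OF f] nn_integral_norm_sq_eq_L2norm[OF g]
        power_mult_distrib
    by (rule ennreal_mult[symmetric]) simp_all
  finally have sq_le: "?I\<^sup>2 \<le> ennreal ((L2norm M f * L2norm M g)\<^sup>2)" .
  then have "?I\<^sup>2 < \<infinity>" using le_less_trans by fastforce
  then have finite: "?I < \<infinity>" by (simp add: power_less_top_ennreal)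
  show integrable: ?integrable
    using finite by (intro integrableI_nonneg) auto
  have "(\<integral>\<omega>. norm (f \<omega>) * norm (g \<omega>) \<partial>M)\<^sup>2 \<le> (L2norm M f * L2norm M g)\<^sup>2"
    using sq_le by (simp add: nn_integral_eq_integral[OF integrable] ennreal_power)
  then show ?le
    by (rule power2_le_imp_le) (simp add: L2norm_nonneg)
qed

lemma integrable_mult_L2: "L2 M M f \<Longrightarrow> L2 M M g \<Longrightarrow> integrable M (\<lambda>\<omega>. f \<omega> * g \<omega>)"
  for f g :: "'a \<Rightarrow> real"
  by (rule Bochner_Integration.integrable_bound[OF integrable_norm_mult_norm[of M f g]])
    (auto simp: L2_def abs_mult)

lemma integrable_inner_L2: "L2 M M f \<Longrightarrow> L2 M M g \<Longrightarrow> integrable M (\<lambda>\<omega>. f \<omega> \<bullet> g \<omega>)"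
  by (rule Bochner_Integration.integrable_bound[OF integrable_norm_mult_norm[of M f g]])
    (auto simp: L2_def Cauchy_Schwarz_ineq2)

lemma L2norm_triangle:
  assumes f: "L2 M M f" and g: "L2 M M g"
  shows "L2norm M (\<lambda>\<omega>. f \<omega> + g \<omega>) \<le> L2norm M f + L2norm M g"
proof (rule power2_le_imp_le)
  note integrable = L2_integrable_norm_sq[OF f] L2_integrable_norm_sq[OF g]
      integrable_norm_mult_norm[OF f g]
  have "(L2norm M (\<lambda>\<omega>. f \<omega> + g \<omega>))\<^sup>2
      \<le> (\<integral>\<omega>. (norm (f \<omega>))\<^sup>2 + (norm (g \<omega>))\<^sup>2 + 2 * (norm (f \<omega>) * norm (g \<omega>)) \<partial>M)"
    unfolding L2norm_power2
  proof (rule integral_mono')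
    fix \<omega>
    have "(norm (f \<omega> + g \<omega>))\<^sup>2 \<le> (norm (f \<omega>) + norm (g \<omega>))\<^sup>2"
      by (intro power_mono norm_triangle_ineq norm_ge_zero)
    then show "(norm (f \<omega> + g \<omega>))\<^sup>2 \<le> (norm (f \<omega>))\<^sup>2 + (norm (g \<omega>))\<^sup>2
        + 2 * (norm (f \<omega>) * norm (g \<omega>))"
      by (simp add: power2_sum)
  qed (use integrable in auto)
  also have "\<dots> = (L2norm M f)\<^sup>2 + (L2norm M g)\<^sup>2 + 2 * (\<integral>\<omega>. norm (f \<omega>) * norm (g \<omega>) \<partial>M)"
    using integrable by (simp add: L2norm_power2)
  also have "\<dots> \<le> (L2norm M f + L2norm M g)\<^sup>2"
    using integral_norm_mult_norm_le[OF f g] by (simp add: power2_sum)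
  finally show "(L2norm M (\<lambda>\<omega>. f \<omega> + g \<omega>))\<^sup>2 \<le> (L2norm M f + L2norm M g)\<^sup>2" .
qed (simp add: L2norm_nonneg)

subsection \<open>Convergence\<close>

text \<open>Membership in \<open>L2\<close> is part of the notion because the Bochner integral of a
  non-integrable function is \<open>0\<close>.\<close>
definition L2_tendsto ::
  "'a measure \<Rightarrow> 'a measure \<Rightarrow> (nat \<Rightarrow> 'a \<Rightarrow> 'b::euclidean_space) \<Rightarrow> ('a \<Rightarrow> 'b) \<Rightarrow> bool" where
  "L2_tendsto M F f g \<longleftrightarrow> (\<forall>j. L2 M F (f j)) \<and> L2 M F g \<and>
     (\<lambda>j. L2norm M (\<lambda>\<omega>. f j \<omega> - g \<omega>)) \<longlonglongrightarrow> 0"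

lemma L2_tendstoD:
  assumes "L2_tendsto M F f g"
  shows "L2 M F (f j)" "L2 M F g" "(\<lambda>j. L2norm M (\<lambda>\<omega>. f j \<omega> - g \<omega>)) \<longlonglongrightarrow> 0"
  using assms by (auto simp: L2_tendsto_def)

lemma L2_tendsto_squeeze:
  assumes f: "\<And>j. L2 M F (f j)" and g: "L2 M F g"
    and h: "h \<longlonglongrightarrow> 0" "\<And>j. L2norm M (\<lambda>\<omega>. f j \<omega> - g \<omega>) \<le> h j"
  shows "L2_tendsto M F f g"
proof -
  have "(\<lambda>j. L2norm M (\<lambda>\<omega>. f j \<omega> - g \<omega>)) \<longlonglongrightarrow> 0"
    by (rule tendsto_sandwich[OF _ _ tendsto_const h(1)]) (auto simp: h(2) L2norm_nonneg)
  with f g show ?thesis by (simp add: L2_tendsto_def)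
qed

lemma L2_tendsto_const: "L2 M F f \<Longrightarrow> L2_tendsto M F (\<lambda>_. f) f"
  by (simp add: L2_tendsto_def L2norm_zero)

lemma L2_tendsto_subalgebra:
  "subalgebra G F \<Longrightarrow> L2_tendsto M F f g \<Longrightarrow> L2_tendsto M G f g"
  by (auto simp: L2_tendsto_def L2_subalgebra)

lemma L2_tendsto_add:
  assumes F: "subalgebra M F" and f: "L2_tendsto M F f f'" and g: "L2_tendsto M F g g'"
  shows "L2_tendsto M F (\<lambda>j \<omega>. f j \<omega> + g j \<omega>) (\<lambda>\<omega>. f' \<omega> + g' \<omega>)"
proof (rule L2_tendsto_squeeze)
  let ?h = "\<lambda>j. L2norm M (\<lambda>\<omega>. f j \<omega> - f' \<omega>) + L2norm M (\<lambda>\<omega>. g j \<omega> - g' \<omega>)"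
  show "?h \<longlonglongrightarrow> 0"
    using tendsto_add[OF L2_tendstoD(3)[OF f] L2_tendstoD(3)[OF g]] by simp
  fix j
  have "L2 M M (\<lambda>\<omega>. f j \<omega> - f' \<omega>)" "L2 M M (\<lambda>\<omega>. g j \<omega> - g' \<omega>)"
    by (intro L2_subalgebra[OF F] L2_diff[OF F] L2_tendstoD[OF f] L2_tendstoD[OF g])+
  from L2norm_triangle[OF this]
  show "L2norm M (\<lambda>\<omega>. f j \<omega> + g j \<omega> - (f' \<omega> + g' \<omega>)) \<le> ?h j"
    by (simp add: algebra_simps)
qed (intro L2_add[OF F] L2_tendstoD[OF f] L2_tendstoD[OF g])+

lemma L2_tendsto_sum:
  assumes F: "subalgebra M F" and f: "\<And>i. i \<in> I \<Longrightarrow> L2_tendsto M F (f i) (g i)"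
  shows "L2_tendsto M F (\<lambda>j \<omega>. \<Sum>i\<in>I. f i j \<omega>) (\<lambda>\<omega>. \<Sum>i\<in>I. g i \<omega>)"
  using f
proof (induction I rule: infinite_finite_induct)
  case (insert i I)
  then show ?case by (simp add: L2_tendsto_add[OF F])
qed (simp_all add: L2_tendsto_const L2_def)

lemma L2_tendsto_bounded_linear:
  fixes T :: "'b::euclidean_space \<Rightarrow> 'c::euclidean_space"
  assumes F: "subalgebra M F" and T: "bounded_linear T" and f: "L2_tendsto M F f g"
  shows "L2_tendsto M F (\<lambda>j \<omega>. T (f j \<omega>)) (\<lambda>\<omega>. T (g \<omega>))"
proof (rule L2_tendsto_squeeze)
  show "L2norm M (\<lambda>\<omega>. T (f j \<omega>) - T (g \<omega>)) \<le> onorm T * L2norm M (\<lambda>\<omega>. f j \<omega> - g \<omega>)" for j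
  proof -
    have "L2norm M (\<lambda>\<omega>. T (f j \<omega>) - T (g \<omega>)) \<le> L2norm M (\<lambda>\<omega>. onorm T *\<^sub>R (f j \<omega> - g \<omega>))"
    proof (rule L2norm_mono)
      show "L2 M M (\<lambda>\<omega>. onorm T *\<^sub>R (f j \<omega> - g \<omega>))"
        by (intro L2_scaleR L2_subalgebra[OF F] L2_diff[OF F] L2_tendstoD[OF f])
      show "norm (T (f j \<omega>) - T (g \<omega>)) \<le> norm (onorm T *\<^sub>R (f j \<omega> - g \<omega>))" for \<omega>
        using onorm[OF T, of "f j \<omega> - g \<omega>"] onorm_pos_le[OF T]
        by (simp add: linear_diff[OF bounded_linear.linear[OF T]])
    qed
    then show ?thesis by (simp add: L2norm_scaleR onorm_pos_le[OF T])
  qed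
  show "(\<lambda>j. onorm T * L2norm M (\<lambda>\<omega>. f j \<omega> - g \<omega>)) \<longlonglongrightarrow> 0"
    using L2_tendstoD(3)[OF f] by (rule tendsto_mult_right_zero)
qed (intro L2_bounded_linear[OF F T] L2_tendstoD[OF f])+

lemma L2_tendsto_Pair:
  fixes f :: "nat \<Rightarrow> 'a \<Rightarrow> 'b::euclidean_space" and g :: "nat \<Rightarrow> 'a \<Rightarrow> 'c::euclidean_space"
  assumes F: "subalgebra M F" and f: "L2_tendsto M F f f'" and g: "L2_tendsto M F g g'"
  shows "L2_tendsto M F (\<lambda>j \<omega>. (f j \<omega>, g j \<omega>)) (\<lambda>\<omega>. (f' \<omega>, g' \<omega>))"
proof -
  have "bounded_linear (\<lambda>x::'b. (x, 0::'c))" "bounded_linear (\<lambda>y::'c. (0::'b, y))"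
    by (intro bounded_linear_Pair bounded_linear_ident bounded_linear_zero)+
  from L2_tendsto_add[OF F L2_tendsto_bounded_linear[OF F this(1) f]
      L2_tendsto_bounded_linear[OF F this(2) g]]
  show ?thesis by simp
qed

lemma L2_tendsto_dominated_convergence:
  fixes f :: "nat \<Rightarrow> 'a \<Rightarrow> 'b::euclidean_space" and h :: "'a \<Rightarrow> 'c::euclidean_space"
  assumes F: "subalgebra M F" and f: "\<And>j. f j \<in> borel_measurable F"
    and lim: "\<And>\<omega>. (\<lambda>j. f j \<omega>) \<longlonglongrightarrow> g \<omega>"
    and h: "L2 M M h" and norm_le: "\<And>j \<omega>. norm (f j \<omega>) \<le> norm (h \<omega>)"
  shows "L2_tendsto M F f g"
proof -
  have g: "g \<in> borel_measurable F"
    by (rule borel_measurable_LIMSEQ_metric[OF f lim])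
  have g_le: "norm (g \<omega>) \<le> norm (h \<omega>)" for \<omega>
    by (rule tendsto_upperbound[OF tendsto_norm[OF lim]]) (auto simp: norm_le)
  have [measurable]: "f j \<in> borel_measurable M" "g \<in> borel_measurable M" for j
    using measurable_from_subalg[OF F] f g by blast+
  have "(\<lambda>j. \<integral>\<omega>. (norm (f j \<omega> - g \<omega>))\<^sup>2 \<partial>M) \<longlonglongrightarrow> (\<integral>\<omega>. 0 \<partial>M)"
  proof (rule integral_dominated_convergence)
    show "integrable M (\<lambda>\<omega>. (norm (2 *\<^sub>R h \<omega>))\<^sup>2)"
      by (rule L2_integrable_norm_sq[OF L2_scaleR[OF h]])
    have "(\<lambda>j. (norm (f j \<omega> - g \<omega>))\<^sup>2) \<longlonglongrightarrow> (norm (g \<omega> - g \<omega>))\<^sup>2" for \<omega>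
      by (intro tendsto_intros lim)
    then show "AE \<omega> in M. (\<lambda>j. (norm (f j \<omega> - g \<omega>))\<^sup>2) \<longlonglongrightarrow> 0" by simp
    fix j
    have "norm (f j \<omega> - g \<omega>) \<le> norm (2 *\<^sub>R h \<omega>)" for \<omega>
      using norm_triangle_ineq4[of "f j \<omega>" "g \<omega>"] norm_le[of j \<omega>] g_le[of \<omega>] by simp
    then have "(norm (f j \<omega> - g \<omega>))\<^sup>2 \<le> (norm (2 *\<^sub>R h \<omega>))\<^sup>2" for \<omega>
      by (rule power_mono) simp
    then show "AE \<omega> in M. norm ((norm (f j \<omega> - g \<omega>))\<^sup>2) \<le> (norm (2 *\<^sub>R h \<omega>))\<^sup>2" by simp
  qed auto
  then have "(\<lambda>j. L2norm M (\<lambda>\<omega>. f j \<omega> - g \<omega>)) \<longlonglongrightarrow> 0"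
    unfolding L2norm_def using tendsto_real_sqrt by fastforce
  then show ?thesis
    unfolding L2_tendsto_def by (intro conjI allI L2_dominated[OF F _ h] f g norm_le g_le)
qed

section \<open>Differentiation along sequences in \<open>L2\<close>\<close>

subsection \<open>Continuously differentiable functions with bounded derivative\<close>

abbreviation (input) fderiv ::
  "('a::real_normed_vector \<Rightarrow> 'b::real_normed_vector) \<Rightarrow> 'a \<Rightarrow> 'a \<Rightarrow> 'b" where
  "fderiv f z \<equiv> frechet_derivative f (at z)"

definition C1_deriv_le ::
  "('a::real_normed_vector \<Rightarrow> 'b::real_normed_vector) \<Rightarrow> ('a \<Rightarrow> real) \<Rightarrow> bool" where
  "C1_deriv_le f B \<longleftrightarrow> C1_map f \<and> (\<forall>z. onorm (fderiv f z) \<le> B z)"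

lemma C1_map_has_derivative: "C1_map f \<Longrightarrow> (f has_derivative fderiv f z) (at z)"
  unfolding C1_map_def using differentiableI frechet_derivative_works by blast

lemma borel_measurable_C1_comp:
  fixes f :: "'b::euclidean_space \<Rightarrow> 'c::euclidean_space"
  assumes f: "C1_map f" and [measurable]: "Z \<in> borel_measurable F"
  shows "(\<lambda>\<omega>. f (Z \<omega>)) \<in> borel_measurable F"
proof -
  have "continuous_on UNIV f"
    using C1_map_has_derivative[OF f]
    by (meson has_derivative_continuous continuous_at_imp_continuous_on)
  then have [measurable]: "f \<in> borel_measurable borel" by (rule borel_measurable_continuous_onI)
  show ?thesis by measurable
qed

lemma borel_measurable_fderiv:
  fixes f :: "'b::euclidean_space \<Rightarrow> 'c::euclidean_space"
  assumes f: "C1_map f" and [measurable]: "Z \<in> borel_measurable F" "Y \<in> borel_measurable F"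
  shows "(\<lambda>\<omega>. fderiv f (Z \<omega>) (Y \<omega>)) \<in> borel_measurable F"
proof -
  obtain D where D: "\<And>z. (f has_derivative blinfun_apply (D z)) (at z)" "continuous_on UNIV D"
    using f by (auto simp: C1_map_def)
  have "continuous_on UNIV (\<lambda>p. blinfun_apply (D (fst p)) (snd p))"
    by (intro continuous_intros continuous_on_compose2[OF D(2)]) auto
  then have "(\<lambda>p. blinfun_apply (D (fst p)) (snd p)) \<in> borel_measurable borel"
    by (rule borel_measurable_continuous_onI)
  moreover have "(\<lambda>\<omega>. (Z \<omega>, Y \<omega>)) \<in> borel_measurable F"
    by (intro borel_measurable_Pair) auto
  ultimately have "(\<lambda>\<omega>. blinfun_apply (D (fst (Z \<omega>, Y \<omega>))) (snd (Z \<omega>, Y \<omega>))) \<in> borel_measurable F"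
    by (rule measurable_compose[rotated])
  then show ?thesis by (simp add: frechet_derivative_at[OF D(1), symmetric])
qed

lemma C1_deriv_leD:
  assumes "C1_deriv_le f B"
  shows "C1_map f" and "(f has_derivative fderiv f z) (at z)"
    and "norm (fderiv f z y) \<le> B z * norm y"
proof -
  show C1: "C1_map f" using assms by (simp add: C1_deriv_le_def)
  show deriv: "(f has_derivative fderiv f z) (at z)" by (rule C1_map_has_derivative[OF C1])
  have "norm (fderiv f z y) \<le> onorm (fderiv f z) * norm y"
    by (rule onorm[OF has_derivative_bounded_linear[OF deriv]])
  also have "\<dots> \<le> B z * norm y"
    using assms by (simp add: C1_deriv_le_def mult_right_mono)
  finally show "norm (fderiv f z y) \<le> B z * norm y" .
qed

lemma C1_deriv_le_linear_growth_nonneg: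
  assumes "C1_deriv_le f (\<lambda>z. c * (1 + norm z))"
  shows "0 \<le> c"
proof -
  have "0 \<le> onorm (fderiv f 0)"
    by (rule onorm_pos_le[OF has_derivative_bounded_linear[OF C1_deriv_leD(2)[OF assms]]])
  also have "\<dots> \<le> c" using assms by (auto simp: C1_deriv_le_def dest: spec[of _ 0])
  finally show ?thesis .
qed

lemma C1_deriv_le_mono:
  assumes "C1_deriv_le f B" and "\<And>z. B z \<le> B' z"
  shows "C1_deriv_le f B'"
  using assms by (auto simp: C1_deriv_le_def intro: order_trans)

lemma has_derivative_slices:
  assumes "(g has_derivative D) (at (x, u))"
  shows "((\<lambda>x'. g (x', u)) has_derivative (\<lambda>h. D (h, 0))) (at x)"
    and "((\<lambda>u'. g (x, u')) has_derivative (\<lambda>h. D (0, h))) (at u)"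
proof -
  have "((\<lambda>x'. (x', u)) has_derivative (\<lambda>h. (h, 0))) (at x)"
    and "((\<lambda>u'. (x, u')) has_derivative (\<lambda>h. (0, h))) (at u)"
    by (auto intro!: derivative_eq_intros)
  from this[THEN has_derivative_compose, OF assms]
  show "((\<lambda>x'. g (x', u)) has_derivative (\<lambda>h. D (h, 0))) (at x)"
    and "((\<lambda>u'. g (x, u')) has_derivative (\<lambda>h. D (0, h))) (at u)"
    by simp_all
qed

lemma C1_deriv_le_case_prod:
  fixes f :: "'x::real_normed_vector \<Rightarrow> 'u::real_normed_vector \<Rightarrow> 'b::real_normed_vector"
  assumes C1: "C1_map (\<lambda>z. f (fst z) (snd z))"
    and partials_le: "\<And>x u. onorm (Dx f x u) + onorm (Du f x u) \<le> B (x, u)"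
  shows "C1_deriv_le (case_prod f) B"
proof -
  have C1': "C1_map (case_prod f)" using C1 by (simp add: case_prod_unfold)
  have "onorm (fderiv (case_prod f) (x, u)) \<le> B (x, u)" for x u
  proof -
    let ?D = "fderiv (case_prod f) (x, u)"
    note deriv = C1_map_has_derivative[OF C1', of "(x, u)"]
    note slices = has_derivative_slices[OF deriv, simplified]
    have partials: "Dx f x u = (\<lambda>h. ?D (h, 0))" "Du f x u = (\<lambda>h. ?D (0, h))"
      unfolding Dx_def Du_def using slices[THEN frechet_derivative_at] by simp_all
    have bounded: "bounded_linear (Dx f x u)" "bounded_linear (Du f x u)"
      unfolding partials by (rule slices[THEN has_derivative_bounded_linear])+
    show ?thesis
    proof (rule onorm_bound)
      show "0 \<le> B (x, u)"
        using partials_le[of x u] bounded[THEN onorm_pos_le] by linarith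
      fix y :: "'x \<times> 'u"
      have "?D y = Dx f x u (fst y) + Du f x u (snd y)"
        unfolding partials
        using linear_add[OF has_derivative_linear[OF deriv], of "(fst y, 0)" "(0, snd y)"] by simp
      then have "norm (?D y) \<le> norm (Dx f x u (fst y)) + norm (Du f x u (snd y))"
        using norm_triangle_ineq by simp
      also have "\<dots> \<le> onorm (Dx f x u) * norm (fst y) + onorm (Du f x u) * norm (snd y)"
        by (intro add_mono onorm bounded)
      also have "\<dots> \<le> onorm (Dx f x u) * norm y + onorm (Du f x u) * norm y"
        by (intro add_mono mult_left_mono onorm_pos_le bounded
            norm_fst_le[of "fst y" "snd y", simplified]
            norm_snd_le[of "snd y" "fst y", simplified])
      also have "\<dots> \<le> B (x, u) * norm y"
        using mult_right_mono[OF partials_le norm_ge_zero] by (simp add: distrib_right)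
      finally show "norm (?D y) \<le> B (x, u) * norm y" .
    qed
  qed
  with C1' show ?thesis by (auto simp: C1_deriv_le_def)
qed

lemma C1_deriv_le_case_prod_linear_growth:
  fixes f :: "'x::real_normed_vector \<Rightarrow> 'u::real_normed_vector \<Rightarrow> 'b::real_normed_vector"
  assumes C1: "C1_map (\<lambda>z. f (fst z) (snd z))" and c_nonneg: "0 \<le> c"
    and partials_le: "\<And>x u. onorm (Dx f x u) + onorm (Du f x u) \<le> c * (1 + norm x + norm u)"
  shows "C1_deriv_le (case_prod f) (\<lambda>z. 2 * c * (1 + norm z))"
proof (rule C1_deriv_le_case_prod[OF C1])
  fix x :: 'x and u :: 'u
  have "c * (1 + norm x + norm u) \<le> c * (2 * (1 + norm (x, u)))"
    using norm_fst_le[of x u] norm_snd_le[of u x] c_nonneg by (intro mult_left_mono) auto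
  with partials_le[of x u] show "onorm (Dx f x u) + onorm (Du f x u) \<le> 2 * c * (1 + norm (x, u))"
    by (simp add: mult.assoc mult.left_commute)
qed

lemma C1_diff_le:
  fixes f :: "'b::real_normed_vector \<Rightarrow> 'c::real_normed_vector"
  assumes f: "C1_deriv_le f B" and bound: "\<And>z. norm z \<le> norm x + norm y \<Longrightarrow> B z \<le> C"
  shows "norm (f x - f y) \<le> C * norm (x - y)"
proof (rule differentiable_bound[where S="cball 0 (norm x + norm y)" and f'="fderiv f"])
  show "onorm (fderiv f z) \<le> C" if "z \<in> cball 0 (norm x + norm y)" for z
    using that f bound[of z] by (auto simp: C1_deriv_le_def intro: order_trans)
qed (auto intro: has_derivative_at_withinI C1_deriv_leD(2)[OF f])

lemma L2_C1_comp:
  fixes f :: "'b::euclidean_space \<Rightarrow> 'c::euclidean_space"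
  assumes finite_M: "finite_measure M" and F: "subalgebra M F"
    and f: "C1_deriv_le f (\<lambda>_. L)" and Z: "L2 M F Z"
  shows "L2 M F (\<lambda>\<omega>. f (Z \<omega>))"
proof (rule L2_dominated[OF F])
  show "L2 M M (\<lambda>\<omega>. norm (f 0) + L * norm (Z \<omega>))"
    by (intro L2_add[OF subalgebra_refl] L2_const[OF finite_M] L2_mult_left L2_norm
        L2_subalgebra[OF F Z])
  show "norm (f (Z \<omega>)) \<le> norm (norm (f 0) + L * norm (Z \<omega>))" for \<omega>
    using C1_diff_le[OF f, of "Z \<omega>" 0 L] norm_triangle_sub[of "f (Z \<omega>)" "f 0"] by auto
qed (rule borel_measurable_C1_comp[OF C1_deriv_leD(1)[OF f] L2_measurable[OF Z]])

lemma L2_fderiv: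
  fixes f :: "'b::euclidean_space \<Rightarrow> 'c::euclidean_space"
  assumes F: "subalgebra M F" and f: "C1_deriv_le f (\<lambda>_. L)"
    and Z: "L2 M F Z" and Y: "L2 M F Y"
  shows "L2 M F (\<lambda>\<omega>. fderiv f (Z \<omega>) (Y \<omega>))"
proof (rule L2_dominated[OF F])
  show "L2 M M (\<lambda>\<omega>. L *\<^sub>R Y \<omega>)" by (intro L2_scaleR L2_subalgebra[OF F Y])
  show "norm (fderiv f (Z \<omega>) (Y \<omega>)) \<le> norm (L *\<^sub>R Y \<omega>)" for \<omega>
    using order_trans[OF C1_deriv_leD(3)[OF f, of "Z \<omega>" "Y \<omega>"]
        mult_right_mono[OF abs_ge_self norm_ge_zero]]
    by simp
qed (rule borel_measurable_fderiv[OF C1_deriv_leD(1)[OF f] L2_measurable[OF Z] L2_measurable[OF Y]])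

lemma L2_fderiv_direction:
  fixes f :: "'b::euclidean_space \<Rightarrow> 'c::euclidean_space"
  assumes finite_M: "finite_measure M" and F: "subalgebra M F"
    and f: "C1_deriv_le f (\<lambda>z. c * (1 + norm z))" and Z: "L2 M F Z"
  shows "L2 M F (\<lambda>\<omega>. fderiv f (Z \<omega>) h)"
proof (rule L2_dominated[OF F])
  show "L2 M M (\<lambda>\<omega>. (c * norm h) * (1 + norm (Z \<omega>)))"
    by (intro L2_mult_left L2_add[OF subalgebra_refl] L2_const[OF finite_M] L2_norm
        L2_subalgebra[OF F Z])
  show "norm (fderiv f (Z \<omega>) h) \<le> norm ((c * norm h) * (1 + norm (Z \<omega>)))" for \<omega>
    using C1_deriv_leD(3)[OF f, of "Z \<omega>" h] by (simp add: ac_simps)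
qed (intro borel_measurable_fderiv C1_deriv_leD(1)[OF f] L2_measurable[OF Z] borel_measurable_const)

lemma L2_inner_fderiv_direction:
  fixes f :: "'b::euclidean_space \<Rightarrow> 'c::euclidean_space"
  assumes F: "subalgebra M F" and f: "C1_deriv_le f (\<lambda>_. L)"
    and Z: "L2 M F Z" and p: "L2 M F p"
  shows "L2 M F (\<lambda>\<omega>. p \<omega> \<bullet> fderiv f (Z \<omega>) h)"
proof (rule L2_dominated[OF F])
  show "L2 M M (\<lambda>\<omega>. (L * norm h) *\<^sub>R p \<omega>)" by (intro L2_scaleR L2_subalgebra[OF F p])
  show "norm (p \<omega> \<bullet> fderiv f (Z \<omega>) h) \<le> norm ((L * norm h) *\<^sub>R p \<omega>)" for \<omega>
  proof -
    have "norm (p \<omega> \<bullet> fderiv f (Z \<omega>) h) \<le> norm (p \<omega>) * norm (fderiv f (Z \<omega>) h)"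
      by (simp add: Cauchy_Schwarz_ineq2)
    also have "\<dots> \<le> norm (p \<omega>) * (L * norm h)"
      by (intro mult_left_mono C1_deriv_leD(3)[OF f]) simp
    also have "\<dots> \<le> norm (p \<omega>) * \<bar>L * norm h\<bar>"
      by (intro mult_left_mono abs_ge_self) simp
    finally show ?thesis by (simp only: norm_scaleR mult.commute)
  qed
  show "(\<lambda>\<omega>. p \<omega> \<bullet> fderiv f (Z \<omega>) h) \<in> borel_measurable F"
    by (intro borel_measurable_inner borel_measurable_fderiv C1_deriv_leD(1)[OF f]
        L2_measurable[OF p] L2_measurable[OF Z] borel_measurable_const)
qed

lemma integrable_C1_comp:
  fixes f :: "'b::euclidean_space \<Rightarrow> real"
  assumes finite_M: "finite_measure M" and f: "C1_deriv_le f (\<lambda>z. c * (1 + norm z))"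
    and Z: "L2 M M Z"
  shows "integrable M (\<lambda>\<omega>. f (Z \<omega>))"
proof (rule Bochner_Integration.integrable_bound)
  let ?g = "\<lambda>\<omega>. \<bar>f 0\<bar> + c * (norm (1 + norm (Z \<omega>)) * norm (Z \<omega>))"
  show "integrable M ?g"
    by (intro Bochner_Integration.integrable_add integrable_mult_right integrable_norm_mult_norm
          L2_add[OF subalgebra_refl] L2_const L2_norm Z finite_measure.integrable_const finite_M)
  have "norm (f (Z \<omega>)) \<le> norm (?g \<omega>)" for \<omega>
  proof -
    have "norm (f (Z \<omega>) - f 0) \<le> c * (1 + norm (Z \<omega>)) * norm (Z \<omega> - 0)"
      by (rule C1_diff_le[OF f]) (simp add: C1_deriv_le_linear_growth_nonneg[OF f] mult_left_mono)
    then show ?thesis by (auto simp: mult.assoc)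
  qed
  then show "AE \<omega> in M. norm (f (Z \<omega>)) \<le> norm (?g \<omega>)" by simp
qed (rule borel_measurable_C1_comp[OF C1_deriv_leD(1)[OF f] L2_measurable[OF Z]])

lemma integrable_fderiv:
  fixes f :: "'b::euclidean_space \<Rightarrow> real"
  assumes finite_M: "finite_measure M" and f: "C1_deriv_le f (\<lambda>z. c * (1 + norm z))"
    and Z: "L2 M M Z" and Y: "L2 M M Y"
  shows "integrable M (\<lambda>\<omega>. fderiv f (Z \<omega>) (Y \<omega>))"
proof (rule Bochner_Integration.integrable_bound)
  let ?g = "\<lambda>\<omega>. c * (norm (1 + norm (Z \<omega>)) * norm (Y \<omega>))"
  show "integrable M ?g"
    by (intro integrable_mult_right integrable_norm_mult_norm L2_add[OF subalgebra_refl]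
          L2_const L2_norm Z Y finite_M)
  have "norm (fderiv f (Z \<omega>) (Y \<omega>)) \<le> norm (?g \<omega>)" for \<omega>
    using C1_deriv_leD(3)[OF f, of "Z \<omega>" "Y \<omega>"] by (auto simp: mult.assoc)
  then show "AE \<omega> in M. norm (fderiv f (Z \<omega>) (Y \<omega>)) \<le> norm (?g \<omega>)" by simp
qed (rule borel_measurable_fderiv[OF C1_deriv_leD(1)[OF f] L2_measurable[OF Z] L2_measurable[OF Y]])

subsection \<open>Difference quotients\<close>

definition step_sizes :: "(nat \<Rightarrow> real) \<Rightarrow> bool" where
  "step_sizes t \<longleftrightarrow> t \<longlonglongrightarrow> 0 \<and> (\<forall>j. 0 < t j \<and> t j \<le> 1)"

lemma step_sizesD:
  assumes "step_sizes t"
  shows "t \<longlonglongrightarrow> 0" "0 < t j" "t j \<le> 1" "t j \<noteq> 0"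
  using assms by (auto simp: step_sizes_def dest: spec[of _ j])

abbreviation (input) line_quotient ::
  "('a::real_normed_vector \<Rightarrow> 'b::real_normed_vector) \<Rightarrow> real \<Rightarrow> 'a \<Rightarrow> 'a \<Rightarrow> 'b" where
  "line_quotient f t z y \<equiv> (f (z + t *\<^sub>R y) - f z) /\<^sub>R t"

lemma line_quotient_tendsto:
  fixes f :: "'b::real_normed_vector \<Rightarrow> 'c::real_normed_vector"
  assumes f: "(f has_derivative D) (at z)" and t: "t \<longlonglongrightarrow> 0" "\<And>j. t j \<noteq> 0"
  shows "(\<lambda>j. line_quotient f (t j) z y) \<longlonglongrightarrow> D y"
proof -
  have "((\<lambda>s. z + s *\<^sub>R y) has_derivative (\<lambda>s. s *\<^sub>R y)) (at 0)"
    by (auto intro!: derivative_eq_intros)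
  from has_derivative_compose[OF this, of f D]
  have "((\<lambda>s. f (z + s *\<^sub>R y)) has_derivative (\<lambda>s. D (s *\<^sub>R y))) (at (0::real))"
    using f by simp
  then have remainder: "((\<lambda>s. norm (f (z + s *\<^sub>R y) - f z - s *\<^sub>R D y) / norm s) \<longlongrightarrow> 0)
      (at (0::real))"
    by (simp add: has_derivative_iff_norm linear_scale[OF has_derivative_linear[OF f]])
  have "filterlim t (at 0) sequentially"
    using t by (auto simp: filterlim_at)
  from filterlim_compose[OF remainder this]
  have "(\<lambda>j. norm (f (z + t j *\<^sub>R y) - f z - t j *\<^sub>R D y) / norm (t j)) \<longlonglongrightarrow> 0" .
  moreover have "norm (f (z + t j *\<^sub>R y) - f z - t j *\<^sub>R D y) / norm (t j)
      = norm (line_quotient f (t j) z y - D y)" for j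
  proof -
    have "line_quotient f (t j) z y - D y = (f (z + t j *\<^sub>R y) - f z - t j *\<^sub>R D y) /\<^sub>R t j"
      using t(2)[of j] by (simp add: scaleR_diff_right)
    then show ?thesis by (simp add: divide_inverse_commute)
  qed
  ultimately show ?thesis
    by (simp add: LIM_zero_cancel tendsto_norm_zero_iff)
qed

lemma quotient_perturbation_le:
  fixes f :: "'b::real_normed_vector \<Rightarrow> 'c::real_normed_vector"
  assumes f: "C1_deriv_le f B" and t: "0 < t"
    and bound: "\<And>x. norm x \<le> norm z' + norm (z + t *\<^sub>R y) \<Longrightarrow> B x \<le> C"
  shows "norm ((f z' - f z) /\<^sub>R t - line_quotient f t z y) \<le> C * norm ((z' - z) /\<^sub>R t - y)"
proof -
  have "norm ((f z' - f z) /\<^sub>R t - line_quotient f t z y)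
      = norm ((f z' - f (z + t *\<^sub>R y)) /\<^sub>R t)"
    by (simp add: scaleR_diff_right)
  also have "\<dots> = inverse t * norm (f z' - f (z + t *\<^sub>R y))" using t by simp
  also have "\<dots> \<le> inverse t * (C * norm (z' - (z + t *\<^sub>R y)))"
    using t by (intro mult_left_mono C1_diff_le[OF f] bound) auto
  also have "z' - (z + t *\<^sub>R y) = t *\<^sub>R ((z' - z) /\<^sub>R t - y)"
    using t by (simp add: scaleR_diff_right)
  also have "inverse t * (C * norm (t *\<^sub>R ((z' - z) /\<^sub>R t - y))) = C * norm ((z' - z) /\<^sub>R t - y)"
    using t by (simp add: mult.left_commute[of C] mult.assoc[symmetric])
  finally show ?thesis .
qed

lemma quotient_perturbation_le_linear_growth:
  fixes f :: "'b::real_normed_vector \<Rightarrow> 'c::real_normed_vector"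
  assumes f: "C1_deriv_le f (\<lambda>z. c * (1 + norm z))" and t: "0 < t" "t \<le> 1"
  defines "d z' z y \<equiv> (z' - z) /\<^sub>R t - y"
  shows "norm ((f z' - f z) /\<^sub>R t - line_quotient f t z y)
    \<le> c * ((1 + 2 * norm z + 2 * norm y) * norm (d z' z y))
      + c * (norm (d z' z y) * norm (d z' z y))"
proof -
  have scaled: "norm (t *\<^sub>R v) \<le> norm v" for v :: 'b
    using t by (simp add: mult_left_le_one_le)
  have "z' = (z + t *\<^sub>R y) + t *\<^sub>R d z' z y"
    using t by (simp add: d_def scaleR_diff_right)
  then have "norm z' \<le> norm (z + t *\<^sub>R y) + norm (t *\<^sub>R d z' z y)"
    by (metis norm_triangle_ineq)
  then have "norm z' + norm (z + t *\<^sub>R y) \<le> 2 * norm z + 2 * norm y + norm (d z' z y)"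
    using norm_triangle_ineq[of z "t *\<^sub>R y"] scaled[of y] scaled[of "d z' z y"] by linarith
  then have "c * (1 + norm x) \<le> c * (1 + 2 * norm z + 2 * norm y + norm (d z' z y))"
    if "norm x \<le> norm z' + norm (z + t *\<^sub>R y)" for x :: 'b
    using that C1_deriv_le_linear_growth_nonneg[OF f] by (intro mult_left_mono) auto
  then have "norm ((f z' - f z) /\<^sub>R t - line_quotient f t z y)
      \<le> c * (1 + 2 * norm z + 2 * norm y + norm (d z' z y)) * norm (d z' z y)"
    unfolding d_def by (rule quotient_perturbation_le[OF f t(1)])
  then show ?thesis by (simp add: distrib_left distrib_right mult.assoc)
qed

subsection \<open>Tangents of sequences\<close>

definition L2_tangent ::
  "'a measure \<Rightarrow> 'a measure \<Rightarrow> (nat \<Rightarrow> real) \<Rightarrow>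
    (nat \<Rightarrow> 'a \<Rightarrow> 'b::euclidean_space) \<Rightarrow> ('a \<Rightarrow> 'b) \<Rightarrow> ('a \<Rightarrow> 'b) \<Rightarrow> bool"
  where "L2_tangent M F t Z z y \<longleftrightarrow>
    L2 M F z \<and> L2_tendsto M F (\<lambda>j \<omega>. (Z j \<omega> - z \<omega>) /\<^sub>R t j) y"

lemma L2_tangentD:
  assumes "L2_tangent M F t Z z y"
  shows "L2 M F z" "L2_tendsto M F (\<lambda>j \<omega>. (Z j \<omega> - z \<omega>) /\<^sub>R t j) y" "L2 M F y"
  using assms by (auto simp: L2_tangent_def L2_tendsto_def)

lemma L2_tangent_sequence:
  assumes F: "subalgebra M F" and t: "step_sizes t" and Z: "L2_tangent M F t Z z y"
  shows "L2 M F (Z j)"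
proof -
  have "L2 M F (\<lambda>\<omega>. t j *\<^sub>R ((Z j \<omega> - z \<omega>) /\<^sub>R t j) + z \<omega>)"
    by (intro L2_add[OF F] L2_scaleR[OF L2_tendstoD(1)[OF L2_tangentD(2)[OF Z]]]
        L2_tangentD(1)[OF Z])
  then show ?thesis using step_sizesD(4)[OF t, of j] by simp
qed

lemma L2_tangent_tendsto:
  assumes F: "subalgebra M F" and t: "step_sizes t" and Z: "L2_tangent M F t Z z y"
  shows "L2_tendsto M F Z z"
proof (rule L2_tendsto_squeeze)
  let ?q = "\<lambda>j \<omega>. (Z j \<omega> - z \<omega>) /\<^sub>R t j"
  let ?h = "\<lambda>j. \<bar>t j\<bar> * (L2norm M (\<lambda>\<omega>. ?q j \<omega> - y \<omega>) + L2norm M y)"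
  note q = L2_tangentD(2)[OF Z]
  show "L2 M F (Z j)" for j by (rule L2_tangent_sequence[OF F t Z])
  show "L2 M F z" by (rule L2_tangentD(1)[OF Z])
  have "?h \<longlonglongrightarrow> \<bar>0\<bar> * (0 + L2norm M y)"
    by (intro tendsto_intros step_sizesD(1)[OF t] L2_tendstoD(3)[OF q])
  then show "?h \<longlonglongrightarrow> 0" by simp
  show "L2norm M (\<lambda>\<omega>. Z j \<omega> - z \<omega>) \<le> ?h j" for j
  proof -
    have "L2 M M (\<lambda>\<omega>. ?q j \<omega> - y \<omega>)" "L2 M M y"
      by (intro L2_subalgebra[OF F] L2_diff[OF F] L2_tendstoD[OF q])+
    from L2norm_triangle[OF this]
    have "\<bar>t j\<bar> * L2norm M (?q j) \<le> ?h j" by (intro mult_left_mono) auto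
    then show ?thesis
      using L2norm_scaleR[of M "t j" "?q j"] step_sizesD(4)[OF t, of j] by simp
  qed
qed

lemma L2_tangent_const: "L2 M F z \<Longrightarrow> L2_tangent M F t (\<lambda>_. z) z (\<lambda>_. 0)"
  by (simp add: L2_tangent_def L2_tendsto_const L2_def)

lemma L2_tangent_subalgebra:
  "subalgebra G F \<Longrightarrow> L2_tangent M F t Z z y \<Longrightarrow> L2_tangent M G t Z z y"
  by (auto simp: L2_tangent_def L2_subalgebra L2_tendsto_subalgebra)

lemma L2_tangent_sum:
  assumes F: "subalgebra M F" and Z: "\<And>i. i \<in> I \<Longrightarrow> L2_tangent M F t (Z i) (z i) (y i)"
  shows "L2_tangent M F t (\<lambda>j \<omega>. \<Sum>i\<in>I. Z i j \<omega>) (\<lambda>\<omega>. \<Sum>i\<in>I. z i \<omega>) (\<lambda>\<omega>. \<Sum>i\<in>I. y i \<omega>)"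
proof -
  have "L2_tendsto M F (\<lambda>j \<omega>. \<Sum>i\<in>I. (Z i j \<omega> - z i \<omega>) /\<^sub>R t j) (\<lambda>\<omega>. \<Sum>i\<in>I. y i \<omega>)"
    by (intro L2_tendsto_sum[OF F] L2_tangentD(2)[OF Z])
  then show ?thesis
    unfolding L2_tangent_def by (auto simp: scaleR_sum_right sum_subtractf scaleR_diff_right
        intro!: L2_sum[OF F] L2_tangentD(1)[OF Z])
qed

lemma L2_tangent_Pair:
  fixes z :: "'a \<Rightarrow> 'b::euclidean_space" and z' :: "'a \<Rightarrow> 'c::euclidean_space"
  assumes F: "subalgebra M F" and Z: "L2_tangent M F t Z z y" and Z': "L2_tangent M F t Z' z' y'"
  shows "L2_tangent M F t (\<lambda>j \<omega>. (Z j \<omega>, Z' j \<omega>)) (\<lambda>\<omega>. (z \<omega>, z' \<omega>)) (\<lambda>\<omega>. (y \<omega>, y' \<omega>))"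
  using L2_tendsto_Pair[OF F L2_tangentD(2)[OF Z] L2_tangentD(2)[OF Z']]
    L2_Pair[OF L2_tangentD(1)[OF Z] L2_tangentD(1)[OF Z']]
  by (simp add: L2_tangent_def)

lemma L2_tendsto_line_quotient:
  fixes f :: "'b::euclidean_space \<Rightarrow> 'c::euclidean_space"
  assumes F: "subalgebra M F" and f: "C1_deriv_le f (\<lambda>_. L)" and t: "step_sizes t"
    and z: "L2 M F z" and y: "L2 M F y"
  shows "L2_tendsto M F (\<lambda>j \<omega>. line_quotient f (t j) (z \<omega>) (y \<omega>)) (\<lambda>\<omega>. fderiv f (z \<omega>) (y \<omega>))"
proof (rule L2_tendsto_dominated_convergence[OF F])
  have [measurable]: "z \<in> borel_measurable F" "y \<in> borel_measurable F"
    using z y by (auto simp: L2_def)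
  note [measurable] = borel_measurable_C1_comp[OF C1_deriv_leD(1)[OF f]]
  show "(\<lambda>\<omega>. line_quotient f (t j) (z \<omega>) (y \<omega>)) \<in> borel_measurable F" for j
    by measurable
  show "(\<lambda>j. line_quotient f (t j) (z \<omega>) (y \<omega>)) \<longlonglongrightarrow> fderiv f (z \<omega>) (y \<omega>)" for \<omega>
    by (rule line_quotient_tendsto[OF C1_deriv_leD(2)[OF f] step_sizesD(1,4)[OF t]])
  show "L2 M M (\<lambda>\<omega>. L *\<^sub>R y \<omega>)" by (intro L2_scaleR L2_subalgebra[OF F y])
  show "norm (line_quotient f (t j) (z \<omega>) (y \<omega>)) \<le> norm (L *\<^sub>R y \<omega>)" for j \<omega>
  proof -
    have "norm (line_quotient f (t j) (z \<omega>) (y \<omega>)) \<le> L * norm (y \<omega>)"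
      using quotient_perturbation_le[OF f step_sizesD(2)[OF t, of j], where z="z \<omega>"
          and z'="z \<omega> + t j *\<^sub>R y \<omega>"
          and y=0 and C=L] step_sizesD(4)[OF t, of j]
      by simp
    also have "\<dots> \<le> norm (L *\<^sub>R y \<omega>)" by (simp add: mult_right_mono)
    finally show ?thesis .
  qed
qed

text \<open>The Lipschitz bound reduces a sequence of directions to its limit, a fixed direction.\<close>
lemma L2_tangent_C1_comp:
  fixes f :: "'b::euclidean_space \<Rightarrow> 'c::euclidean_space"
  assumes finite_M: "finite_measure M" and F: "subalgebra M F" and f: "C1_deriv_le f (\<lambda>_. L)"
    and t: "step_sizes t" and Z: "L2_tangent M F t Z z y"
  shows "L2_tangent M F t (\<lambda>j \<omega>. f (Z j \<omega>)) (\<lambda>\<omega>. f (z \<omega>)) (\<lambda>\<omega>. fderiv f (z \<omega>) (y \<omega>))"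
proof -
  let ?q = "\<lambda>j \<omega>. (f (Z j \<omega>) - f (z \<omega>)) /\<^sub>R t j"
  let ?l = "\<lambda>j \<omega>. line_quotient f (t j) (z \<omega>) (y \<omega>)"
  let ?d = "\<lambda>j \<omega>. (Z j \<omega> - z \<omega>) /\<^sub>R t j - y \<omega>"
  note z = L2_tangentD(1)[OF Z] and y = L2_tangentD(3)[OF Z] and d = L2_tangentD(2)[OF Z]
  have fz: "L2 M F (\<lambda>\<omega>. f (z \<omega>))" by (rule L2_C1_comp[OF finite_M F f z])
  have line: "L2_tendsto M F ?l (\<lambda>\<omega>. fderiv f (z \<omega>) (y \<omega>))"
    by (rule L2_tendsto_line_quotient[OF F f t z y])
  have "L2_tendsto M F (\<lambda>j \<omega>. ?q j \<omega> - ?l j \<omega>) (\<lambda>\<omega>. 0)"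
  proof (rule L2_tendsto_squeeze)
    show "L2 M F (\<lambda>\<omega>. ?q j \<omega> - ?l j \<omega>)" for j
      by (intro L2_diff[OF F] L2_scaleR fz L2_tendstoD(1)[OF line]
            L2_C1_comp[OF finite_M F f L2_tangent_sequence[OF F t Z]])
    show "(\<lambda>j. \<bar>L\<bar> * L2norm M (?d j)) \<longlonglongrightarrow> 0"
      using L2_tendstoD(3)[OF d] by (rule tendsto_mult_right_zero)
    show "L2norm M (\<lambda>\<omega>. ?q j \<omega> - ?l j \<omega> - 0) \<le> \<bar>L\<bar> * L2norm M (?d j)" for j
    proof -
      have "norm (?q j \<omega> - ?l j \<omega> - 0) \<le> norm (L *\<^sub>R ?d j \<omega>)" for \<omega>
      proof -
        have "norm (?q j \<omega> - ?l j \<omega>) \<le> L * norm (?d j \<omega>)"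
          by (rule quotient_perturbation_le[OF f step_sizesD(2)[OF t]]) simp
        also have "\<dots> \<le> norm (L *\<^sub>R ?d j \<omega>)" by (simp add: mult_right_mono)
        finally show ?thesis by simp
      qed
      moreover have "L2 M M (\<lambda>\<omega>. L *\<^sub>R ?d j \<omega>)"
        by (intro L2_scaleR L2_subalgebra[OF F] L2_diff[OF F] L2_tendstoD(1)[OF d] y)
      ultimately have "L2norm M (\<lambda>\<omega>. ?q j \<omega> - ?l j \<omega> - 0) \<le> L2norm M (\<lambda>\<omega>. L *\<^sub>R ?d j \<omega>)"
        by (intro L2norm_mono)
      then show ?thesis unfolding L2norm_scaleR .
    qed
  qed (simp add: L2_def)
  from L2_tendsto_add[OF F this line] fz show ?thesis by (simp add: L2_tangent_def)
qed

lemma integral_line_quotient_tendsto: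
  fixes f :: "'b::euclidean_space \<Rightarrow> real"
  assumes finite_M: "finite_measure M" and f: "C1_deriv_le f (\<lambda>z. c * (1 + norm z))"
    and t: "step_sizes t" and z: "L2 M M z" and y: "L2 M M y"
  shows "(\<lambda>j. \<integral>\<omega>. line_quotient f (t j) (z \<omega>) (y \<omega>) \<partial>M) \<longlonglongrightarrow> (\<integral>\<omega>. fderiv f (z \<omega>) (y \<omega>) \<partial>M)"
proof (rule integral_dominated_convergence)
  let ?C = "\<lambda>\<omega>. 1 + 2 * norm (z \<omega>)"
  let ?w = "\<lambda>\<omega>. c * (norm (?C \<omega>) * norm (y \<omega>)) + c * (norm (y \<omega>) * norm (y \<omega>))"
  note subalg_M = subalgebra_refl[of M]
  show "integrable M ?w"
    by (intro Bochner_Integration.integrable_add integrable_mult_right integrable_norm_mult_norm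
          L2_add[OF subalg_M] L2_const[OF finite_M] L2_mult_left L2_norm z y)
  have "integrable M (\<lambda>\<omega>. line_quotient f (t j) (z \<omega>) (y \<omega>))" for j
    by (intro integrable_scaleR_right Bochner_Integration.integrable_diff
        integrable_C1_comp[OF finite_M f]
          L2_add[OF subalg_M] L2_scaleR z y)
  then show "(\<lambda>\<omega>. line_quotient f (t j) (z \<omega>) (y \<omega>)) \<in> borel_measurable M" for j
    by (rule borel_measurable_integrable)
  show "(\<lambda>\<omega>. fderiv f (z \<omega>) (y \<omega>)) \<in> borel_measurable M"
    by (rule borel_measurable_integrable[OF integrable_fderiv[OF finite_M f z y]])
  show "AE \<omega> in M. (\<lambda>j. line_quotient f (t j) (z \<omega>) (y \<omega>)) \<longlonglongrightarrow> fderiv f (z \<omega>) (y \<omega>)"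
    using line_quotient_tendsto[OF C1_deriv_leD(2)[OF f] step_sizesD(1,4)[OF t]] by simp
  have "norm (line_quotient f (t j) (z \<omega>) (y \<omega>)) \<le> ?w \<omega>" for j \<omega>
    using quotient_perturbation_le_linear_growth[OF f step_sizesD(2,3)[OF t, of j],
        of "z \<omega> + t j *\<^sub>R y \<omega>" "z \<omega>" 0] step_sizesD(4)[OF t, of j]
    by simp
  then show "AE \<omega> in M. norm (line_quotient f (t j) (z \<omega>) (y \<omega>)) \<le> ?w \<omega>" for j
    by simp
qed

lemma integral_quotient_perturbation_tendsto_0:
  fixes f :: "'b::euclidean_space \<Rightarrow> real"
  assumes finite_M: "finite_measure M" and f: "C1_deriv_le f (\<lambda>z. c * (1 + norm z))"
    and t: "step_sizes t" and Z: "L2_tangent M M t Z z y"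
  shows "(\<lambda>j. \<integral>\<omega>. \<bar>(f (Z j \<omega>) - f (z \<omega>)) /\<^sub>R t j - line_quotient f (t j) (z \<omega>) (y \<omega>)\<bar> \<partial>M) \<longlonglongrightarrow> 0"
    (is "(\<lambda>j. ?I j) \<longlonglongrightarrow> 0")
proof (rule tendsto_sandwich[OF _ _ tendsto_const])
  let ?d = "\<lambda>j \<omega>. (Z j \<omega> - z \<omega>) /\<^sub>R t j - y \<omega>"
  let ?C = "\<lambda>\<omega>. 1 + 2 * norm (z \<omega>) + 2 * norm (y \<omega>)"
  let ?h = "\<lambda>j. c * (L2norm M ?C * L2norm M (?d j)) + c * (L2norm M (?d j) * L2norm M (?d j))"
  note subalg_M = subalgebra_refl[of M] and c_nonneg = C1_deriv_le_linear_growth_nonneg[OF f]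
  note z = L2_tangentD(1)[OF Z] and y = L2_tangentD(3)[OF Z]
  have "?h \<longlonglongrightarrow> c * (L2norm M ?C * 0) + c * (0 * 0)"
    by (intro tendsto_intros L2_tendstoD(3)[OF L2_tangentD(2)[OF Z]])
  then show "?h \<longlonglongrightarrow> 0" by simp
  have weight: "L2 M M ?C"
    by (intro L2_add[OF subalg_M] L2_const[OF finite_M] L2_mult_left L2_norm z y)
  have perturbation: "L2 M M (?d j)" for j
    by (intro L2_diff[OF subalg_M] L2_scaleR L2_tangent_sequence[OF subalg_M t Z] z y)
  have "?I j \<le> ?h j" for j
  proof -
    have "?I j \<le> (\<integral>\<omega>. c * (norm (?C \<omega>) * norm (?d j \<omega>)) + c * (norm (?d j \<omega>) * norm (?d j \<omega>)) \<partial>M)"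
    proof (rule integral_mono')
      show "\<bar>(f (Z j \<omega>) - f (z \<omega>)) /\<^sub>R t j - line_quotient f (t j) (z \<omega>) (y \<omega>)\<bar>
          \<le> c * (norm (?C \<omega>) * norm (?d j \<omega>)) + c * (norm (?d j \<omega>) * norm (?d j \<omega>))" for \<omega>
        using quotient_perturbation_le_linear_growth[OF f step_sizesD(2,3)[OF t],
            of j "Z j \<omega>" "z \<omega>" "y \<omega>"]
        by simp
    qed (intro add_nonneg_nonneg mult_nonneg_nonneg c_nonneg norm_ge_zero
        Bochner_Integration.integrable_add integrable_mult_right integrable_norm_mult_norm
        weight perturbation)+
    also have "\<dots> = c * (\<integral>\<omega>. norm (?C \<omega>) * norm (?d j \<omega>) \<partial>M)
        + c * (\<integral>\<omega>. norm (?d j \<omega>) * norm (?d j \<omega>) \<partial>M)"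
      using integrable_norm_mult_norm[OF weight perturbation]
          integrable_norm_mult_norm[OF perturbation perturbation] by simp
    also have "\<dots> \<le> ?h j"
      by (intro add_mono mult_left_mono integral_norm_mult_norm_le weight perturbation c_nonneg)
    finally show ?thesis .
  qed
  then show "\<forall>\<^sub>F j in sequentially. ?I j \<le> ?h j" by simp
qed simp

lemma integral_tangent:
  fixes f :: "'b::euclidean_space \<Rightarrow> real"
  assumes finite_M: "finite_measure M" and f: "C1_deriv_le f (\<lambda>z. c * (1 + norm z))"
    and t: "step_sizes t" and Z: "L2_tangent M M t Z z y"
  shows "(\<lambda>j. ((\<integral>\<omega>. f (Z j \<omega>) \<partial>M) - (\<integral>\<omega>. f (z \<omega>) \<partial>M)) / t j) \<longlonglongrightarrow> (\<integral>\<omega>. fderiv f (z \<omega>) (y \<omega>) \<partial>M)"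
proof -
  let ?q = "\<lambda>j \<omega>. (f (Z j \<omega>) - f (z \<omega>)) /\<^sub>R t j"
  let ?l = "\<lambda>j \<omega>. line_quotient f (t j) (z \<omega>) (y \<omega>)"
  note subalg_M = subalgebra_refl[of M]
  note z = L2_tangentD(1)[OF Z] and y = L2_tangentD(3)[OF Z]
    and Zj = L2_tangent_sequence[OF subalg_M t Z]
  have integrable: "integrable M (?q j)" "integrable M (?l j)" for j
    by (intro integrable_scaleR_right Bochner_Integration.integrable_diff
        integrable_C1_comp[OF finite_M f]
          Zj L2_add[OF subalg_M] L2_scaleR z y)+
  have "(\<lambda>j. (\<integral>\<omega>. ?q j \<omega> \<partial>M) - (\<integral>\<omega>. ?l j \<omega> \<partial>M)) \<longlonglongrightarrow> 0"
  proof (rule Lim_null_comparison)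
    have "norm ((\<integral>\<omega>. ?q j \<omega> \<partial>M) - (\<integral>\<omega>. ?l j \<omega> \<partial>M)) \<le> (\<integral>\<omega>. \<bar>?q j \<omega> - ?l j \<omega>\<bar> \<partial>M)" for j
      using integral_abs_bound[of M "\<lambda>\<omega>. ?q j \<omega> - ?l j \<omega>"]
      unfolding Bochner_Integration.integral_diff[OF integrable] by simp
    then show "\<forall>\<^sub>F j in sequentially.
        norm ((\<integral>\<omega>. ?q j \<omega> \<partial>M) - (\<integral>\<omega>. ?l j \<omega> \<partial>M)) \<le> (\<integral>\<omega>. \<bar>?q j \<omega> - ?l j \<omega>\<bar> \<partial>M)" by simp
  qed (rule integral_quotient_perturbation_tendsto_0[OF finite_M f t Z])
  from tendsto_add[OF this integral_line_quotient_tendsto[OF finite_M f t z y]]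
  have "(\<lambda>j. \<integral>\<omega>. ?q j \<omega> \<partial>M) \<longlonglongrightarrow> (\<integral>\<omega>. fderiv f (z \<omega>) (y \<omega>) \<partial>M)" by simp
  then show ?thesis
    using integrable_C1_comp[OF finite_M f Zj] integrable_C1_comp[OF finite_M f z]
    by (simp add: divide_inverse_commute)
qed

section \<open>Conditional expectation\<close>

lemma quadratic_nonneg_on_Rats_imp_discriminant:
  fixes a b c :: real
  assumes nonneg: "\<And>s. s \<in> \<rat> \<Longrightarrow> 0 \<le> a * s\<^sup>2 + 2 * b * s + c" and a_nonneg: "0 \<le> a"
  shows "b\<^sup>2 \<le> a * c"
proof -
  have nonneg': "0 \<le> a * s\<^sup>2 + 2 * b * s + c" for s
    by (rule continuous_ge_on_closure[where S="\<rat>"])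
      (auto intro!: continuous_intros nonneg simp: Rats_closure_real)
  show ?thesis
  proof (cases "a = 0")
    case True
    have "b = 0"
    proof (rule ccontr)
      assume "b \<noteq> 0"
      then show False using nonneg'[of "- (c + 1) / (2 * b)"] True by simp
    qed
    with True show ?thesis by simp
  next
    case False
    have "0 \<le> a * (a * (- b / a)\<^sup>2 + 2 * b * (- b / a) + c)"
      using nonneg' a_nonneg by (rule mult_nonneg_nonneg[rotated])
    also have "\<dots> = a * c - b\<^sup>2"
      using False by (simp add: field_simps power2_eq_square)
    finally show ?thesis by simp
  qed
qed

lemma (in sigma_finite_subalgebra) real_cond_exp_Cauchy_Schwarz:
  assumes f: "L2 M M f" and g: "L2 M M g"
  shows "AE \<omega> in M. (real_cond_exp M F (\<lambda>\<omega>. f \<omega> * g \<omega>) \<omega>)\<^sup>2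
    \<le> real_cond_exp M F (\<lambda>\<omega>. (f \<omega>)\<^sup>2) \<omega> * real_cond_exp M F (\<lambda>\<omega>. (g \<omega>)\<^sup>2) \<omega>"
proof -
  let ?ff = "real_cond_exp M F (\<lambda>\<omega>. (f \<omega>)\<^sup>2)" and ?gg = "real_cond_exp M F (\<lambda>\<omega>. (g \<omega>)\<^sup>2)"
    and ?fg = "real_cond_exp M F (\<lambda>\<omega>. f \<omega> * g \<omega>)"
  have [measurable]: "f \<in> borel_measurable M" "g \<in> borel_measurable M"
    using f g by (auto simp: L2_def)
  have integrable: "integrable M (\<lambda>\<omega>. (f \<omega>)\<^sup>2)" "integrable M (\<lambda>\<omega>. (g \<omega>)\<^sup>2)"
      "integrable M (\<lambda>\<omega>. f \<omega> * g \<omega>)"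
    using f g integrable_mult_L2[OF f g] by (auto simp: L2_def)
  have "AE \<omega> in M. 0 \<le> ?ff \<omega> * s\<^sup>2 + 2 * ?fg \<omega> * s + ?gg \<omega>" for s
  proof -
    have square: "(s * f \<omega> + g \<omega>)\<^sup>2 = s\<^sup>2 * (f \<omega>)\<^sup>2 + (2 * s) * (f \<omega> * g \<omega>) + (g \<omega>)\<^sup>2" for \<omega>
      by (simp add: power2_eq_square algebra_simps)
    have "AE \<omega> in M. 0 \<le> real_cond_exp M F (\<lambda>\<omega>. (s * f \<omega> + g \<omega>)\<^sup>2) \<omega>"
      by (rule real_cond_exp_pos) auto
    moreover have "AE \<omega> in M. real_cond_exp M F (\<lambda>\<omega>. (s * f \<omega> + g \<omega>)\<^sup>2) \<omega>
        = real_cond_exp M F (\<lambda>\<omega>. s\<^sup>2 * (f \<omega>)\<^sup>2 + (2 * s) * (f \<omega> * g \<omega>)) \<omega> + ?gg \<omega>"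
      unfolding square using integrable
      by (intro real_cond_exp_add Bochner_Integration.integrable_add integrable_mult_right)
    moreover have "AE \<omega> in M. real_cond_exp M F (\<lambda>\<omega>. s\<^sup>2 * (f \<omega>)\<^sup>2 + (2 * s) * (f \<omega> * g \<omega>)) \<omega>
        = real_cond_exp M F (\<lambda>\<omega>. s\<^sup>2 * (f \<omega>)\<^sup>2) \<omega> + real_cond_exp M F (\<lambda>\<omega>. (2 * s) * (f \<omega> * g \<omega>)) \<omega>"
      using integrable by (intro real_cond_exp_add integrable_mult_right)
    moreover have "AE \<omega> in M. real_cond_exp M F (\<lambda>\<omega>. s\<^sup>2 * (f \<omega>)\<^sup>2) \<omega> = s\<^sup>2 * ?ff \<omega>"
      using integrable by (intro real_cond_exp_cmult)
    moreover have "AE \<omega> in M. real_cond_exp M F (\<lambda>\<omega>. (2 * s) * (f \<omega> * g \<omega>)) \<omega> = (2 * s) * ?fg \<omega>"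
      using integrable by (intro real_cond_exp_cmult)
    ultimately show ?thesis
      by eventually_elim (simp add: ac_simps)
  qed
  then have "AE \<omega> in M. \<forall>s\<in>\<rat>. 0 \<le> ?ff \<omega> * s\<^sup>2 + 2 * ?fg \<omega> * s + ?gg \<omega>"
    by (subst AE_ball_countable[OF countable_rat]) simp
  moreover have "AE \<omega> in M. 0 \<le> ?ff \<omega>"
    by (rule real_cond_exp_pos) auto
  ultimately show ?thesis
    by eventually_elim (rule quadratic_nonneg_on_Rats_imp_discriminant; simp)
qed

text \<open>This says \<open>E(W\<^sup>2 | F) = 1\<close>: multiplication by \<open>W\<close> is an isometry from the \<open>F\<close>-measurable
  square integrable functions into all square integrable functions.\<close>
definition isometric_multiplier :: "'a measure \<Rightarrow> 'a measure \<Rightarrow> ('a \<Rightarrow> real) \<Rightarrow> bool" where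
  "isometric_multiplier M F W \<longleftrightarrow> W \<in> borel_measurable M \<and>
     (\<forall>g::'a \<Rightarrow> real. g \<in> borel_measurable F \<and> integrable M g \<longrightarrow>
        integrable M (\<lambda>\<omega>. (W \<omega>)\<^sup>2 * g \<omega>) \<and> (\<integral>\<omega>. (W \<omega>)\<^sup>2 * g \<omega> \<partial>M) = (\<integral>\<omega>. g \<omega> \<partial>M))"

lemma isometric_multiplierD:
  assumes "isometric_multiplier M F W"
  shows "W \<in> borel_measurable M"
    and "g \<in> borel_measurable F \<Longrightarrow> integrable M g \<Longrightarrow> integrable M (\<lambda>\<omega>. (W \<omega>)\<^sup>2 * g \<omega>)"
    and "g \<in> borel_measurable F \<Longrightarrow> integrable M g \<Longrightarrow> (\<integral>\<omega>. (W \<omega>)\<^sup>2 * g \<omega> \<partial>M) = (\<integral>\<omega>. g \<omega> \<partial>M)"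
  using assms by (auto simp: isometric_multiplier_def)

lemma isometric_multiplier_1: "isometric_multiplier M F (\<lambda>_. 1)"
  by (simp add: isometric_multiplier_def)

lemma L2_isometric_multiplier:
  assumes W: "isometric_multiplier M F W" "W \<in> borel_measurable G"
    and G: "subalgebra G F" and g: "L2 M F g"
  shows "L2 M G (\<lambda>\<omega>. W \<omega> *\<^sub>R g \<omega>)"
  unfolding L2_def
proof
  have "g \<in> borel_measurable G" by (rule measurable_from_subalg[OF G L2_measurable[OF g]])
  with W(2) show "(\<lambda>\<omega>. W \<omega> *\<^sub>R g \<omega>) \<in> borel_measurable G" by measurable
  have "integrable M (\<lambda>\<omega>. (W \<omega>)\<^sup>2 * (norm (g \<omega>))\<^sup>2)"
    using g by (intro isometric_multiplierD(2)[OF W(1)]) (auto simp: L2_def)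
  then show "integrable M (\<lambda>\<omega>. (norm (W \<omega> *\<^sub>R g \<omega>))\<^sup>2)" by (simp add: power_mult_distrib)
qed

lemma L2norm_isometric_multiplier:
  assumes W: "isometric_multiplier M F W" and g: "L2 M F g"
  shows "L2norm M (\<lambda>\<omega>. W \<omega> *\<^sub>R g \<omega>) = L2norm M g"
proof -
  have "(\<integral>\<omega>. (W \<omega>)\<^sup>2 * (norm (g \<omega>))\<^sup>2 \<partial>M) = (\<integral>\<omega>. (norm (g \<omega>))\<^sup>2 \<partial>M)"
    using g by (intro isometric_multiplierD(3)[OF W]) (auto simp: L2_def)
  then show ?thesis by (simp add: L2norm_def power_mult_distrib)
qed

lemma L2_tangent_isometric_multiplier:
  assumes W: "isometric_multiplier M F W" "W \<in> borel_measurable G"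
    and F: "subalgebra M F" and G: "subalgebra G F" and Z: "L2_tangent M F t Z z y"
  shows "L2_tangent M G t (\<lambda>j \<omega>. W \<omega> *\<^sub>R Z j \<omega>) (\<lambda>\<omega>. W \<omega> *\<^sub>R z \<omega>) (\<lambda>\<omega>. W \<omega> *\<^sub>R y \<omega>)"
proof -
  note q = L2_tangentD(2)[OF Z]
  have "L2_tendsto M G (\<lambda>j \<omega>. W \<omega> *\<^sub>R ((Z j \<omega> - z \<omega>) /\<^sub>R t j)) (\<lambda>\<omega>. W \<omega> *\<^sub>R y \<omega>)"
  proof (rule L2_tendsto_squeeze)
    show "L2norm M (\<lambda>\<omega>. W \<omega> *\<^sub>R ((Z j \<omega> - z \<omega>) /\<^sub>R t j) - W \<omega> *\<^sub>R y \<omega>)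
        \<le> L2norm M (\<lambda>\<omega>. (Z j \<omega> - z \<omega>) /\<^sub>R t j - y \<omega>)" for j
      using L2norm_isometric_multiplier[OF W(1) L2_diff[OF F L2_tendstoD(1,2)[OF q]]]
      by (simp add: scaleR_diff_right)
  qed (intro L2_isometric_multiplier[OF W G] L2_tendstoD[OF q])+
  then show ?thesis
    using L2_isometric_multiplier[OF W G L2_tangentD(1)[OF Z]]
    by (simp add: L2_tangent_def scaleR_diff_right mult.commute)
qed

lemma cond_exp_vec_cong_AE:
  fixes f g :: "'a \<Rightarrow> real^'n::finite"
  assumes F: "sigma_finite_subalgebra M F"
    and f: "f \<in> borel_measurable M" and g: "g \<in> borel_measurable M"
    and AE_eq: "AE \<omega> in M. f \<omega> = g \<omega>"
  shows "AE \<omega> in M. cond_exp_vec M F f \<omega> = cond_exp_vec M F g \<omega>"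
proof -
  interpret sigma_finite_subalgebra M F by (rule F)
  note nth = borel_measurable_vec_nth
  have "AE \<omega> in M. real_cond_exp M F (\<lambda>\<omega>. f \<omega> $ j) \<omega> = real_cond_exp M F (\<lambda>\<omega>. g \<omega> $ j) \<omega>" for j
    using AE_eq
    by (intro real_cond_exp_cong measurable_compose[OF f nth] measurable_compose[OF g nth]) auto
  then have "AE \<omega> in M. \<forall>j. real_cond_exp M F (\<lambda>\<omega>. f \<omega> $ j) \<omega> = real_cond_exp M F (\<lambda>\<omega>. g \<omega> $ j) \<omega>"
    by (simp add: AE_all_countable)
  then show ?thesis by eventually_elim (simp add: cond_exp_vec_def)
qed

context finite_measure_subalgebra
begin

lemma L2_if_isometric_multiplier:
  assumes W: "isometric_multiplier M F W"
  shows "L2 M M W"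
proof -
  have "integrable M (\<lambda>\<omega>. (W \<omega>)\<^sup>2 * 1)"
    by (rule isometric_multiplierD(2)[OF W]) simp_all
  then show ?thesis using isometric_multiplierD(1)[OF W] by (simp add: L2_def)
qed

lemma real_cond_exp_isometric_multiplier_square:
  assumes W: "isometric_multiplier M F W"
  shows "AE \<omega> in M. real_cond_exp M F (\<lambda>\<omega>. (W \<omega>)\<^sup>2) \<omega> = 1"
proof -
  interpret sigma_finite_subalgebra M F
    by (rule finite_measure_subalgebra_is_sigma_finite) unfold_locales
  show ?thesis
  proof (rule real_cond_exp_charact)
    fix A assume A: "A \<in> sets F"
    then have "A \<in> sets M" using subalg by (auto simp: subalgebra_def)
    with A have "(\<integral>\<omega>. (W \<omega>)\<^sup>2 * indicator A \<omega> \<partial>M) = (\<integral>\<omega>. indicator A \<omega> \<partial>M)"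
      by (intro isometric_multiplierD(3)[OF W]) (auto simp: emeasure_finite less_top[symmetric])
    then show "(LINT \<omega>:A|M. (W \<omega>)\<^sup>2) = (LINT \<omega>:A|M. 1)"
      by (simp add: set_lebesgue_integral_def mult.commute)
  qed (use L2_if_isometric_multiplier[OF W] in \<open>auto simp: L2_def\<close>)
qed

lemma L2_real_cond_exp_isometric_multiplier:
  assumes W: "isometric_multiplier M F W" and G: "L2 M M G"
  shows "L2 M F (real_cond_exp M F (\<lambda>\<omega>. W \<omega> * G \<omega>))"
  unfolding L2_def
proof
  interpret sigma_finite_subalgebra M F
    by (rule finite_measure_subalgebra_is_sigma_finite) unfold_locales
  show measurable: "real_cond_exp M F (\<lambda>\<omega>. W \<omega> * G \<omega>) \<in> borel_measurable F" by simp
  have "integrable M (real_cond_exp M F (\<lambda>\<omega>. (G \<omega>)\<^sup>2))"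
    using G by (intro real_cond_exp_int) (simp add: L2_def)
  then show "integrable M (\<lambda>\<omega>. (norm (real_cond_exp M F (\<lambda>\<omega>. W \<omega> * G \<omega>) \<omega>))\<^sup>2)"
  proof (rule Bochner_Integration.integrable_bound)
    show "AE \<omega> in M. norm ((norm (real_cond_exp M F (\<lambda>\<omega>. W \<omega> * G \<omega>) \<omega>))\<^sup>2)
        \<le> norm (real_cond_exp M F (\<lambda>\<omega>. (G \<omega>)\<^sup>2) \<omega>)"
      using real_cond_exp_Cauchy_Schwarz[OF L2_if_isometric_multiplier[OF W] G]
        real_cond_exp_isometric_multiplier_square[OF W]
      by eventually_elim simp
  qed (use measurable_from_subalg[OF subalg measurable] in measurable)
qed

lemma L2_cond_exp_vec_isometric_multiplier:
  fixes G :: "'a \<Rightarrow> real^'n::finite"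
  assumes W: "isometric_multiplier M F W" and G: "L2 M M G"
  shows "L2 M F (cond_exp_vec M F (\<lambda>\<omega>. W \<omega> *\<^sub>R G \<omega>))"
  unfolding cond_exp_vec_def
  by (rule L2_componentwise)
    (simp add: L2_real_cond_exp_isometric_multiplier[OF W L2_nth[OF subalgebra_refl G]])

lemma integral_cond_exp_vec_isometric_multiplier:
  fixes G y :: "'a \<Rightarrow> real^'n::finite"
  assumes W: "isometric_multiplier M F W" and G: "L2 M M G" and y: "L2 M F y"
  shows "(\<integral>\<omega>. cond_exp_vec M F (\<lambda>\<omega>. W \<omega> *\<^sub>R G \<omega>) \<omega> \<bullet> y \<omega> \<partial>M) = (\<integral>\<omega>. G \<omega> \<bullet> (W \<omega> *\<^sub>R y \<omega>) \<partial>M)"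
proof -
  interpret sigma_finite_subalgebra M F
    by (rule finite_measure_subalgebra_is_sigma_finite) unfold_locales
  note [measurable] = isometric_multiplierD(1)[OF W]
  have Gj: "L2 M M (\<lambda>\<omega>. G \<omega> $ j)" and yj: "L2 M F (\<lambda>\<omega>. y \<omega> $ j)" for j
    by (rule L2_nth[OF subalgebra_refl G] L2_nth[OF subalg y])+
  have integrable: "integrable M (\<lambda>\<omega>. y \<omega> $ j * (W \<omega> * G \<omega> $ j))" for j
    using integrable_mult_L2[OF
        L2_isometric_multiplier[OF W isometric_multiplierD(1)[OF W] subalg yj] Gj]
    by (simp add: ac_simps)
  have "(\<lambda>\<omega>. W \<omega> * G \<omega> $ j) \<in> borel_measurable M" for j
    using L2_measurable[OF Gj] by measurable
  note tower = real_cond_exp_intg[OF integrable L2_measurable[OF yj] this]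
  have "(\<integral>\<omega>. cond_exp_vec M F (\<lambda>\<omega>. W \<omega> *\<^sub>R G \<omega>) \<omega> \<bullet> y \<omega> \<partial>M)
      = (\<integral>\<omega>. (\<Sum>j\<in>UNIV. y \<omega> $ j * real_cond_exp M F (\<lambda>\<omega>. W \<omega> * G \<omega> $ j) \<omega>) \<partial>M)"
    by (simp add: cond_exp_vec_def inner_vec_def mult.commute)
  also have "\<dots> = (\<Sum>j\<in>UNIV. \<integral>\<omega>. y \<omega> $ j * (W \<omega> * G \<omega> $ j) \<partial>M)"
    using tower by (subst Bochner_Integration.integral_sum) auto
  also have "\<dots> = (\<integral>\<omega>. (\<Sum>j\<in>UNIV. y \<omega> $ j * (W \<omega> * G \<omega> $ j)) \<partial>M)"
    using integrable by (subst Bochner_Integration.integral_sum) auto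
  also have "\<dots> = (\<integral>\<omega>. G \<omega> \<bullet> (W \<omega> *\<^sub>R y \<omega>) \<partial>M)"
    by (simp add: inner_vec_def ac_simps sum_distrib_left)
  finally show ?thesis .
qed

end

section \<open>Controlled recursions\<close>

locale controlled_recursion = finite_measure M for M :: "'a measure" +
  fixes F :: "nat \<Rightarrow> 'a measure" and N :: nat and W :: "nat \<Rightarrow> 'i::finite \<Rightarrow> 'a \<Rightarrow> real"
    and x0 :: "'x::euclidean_space"
    and f :: "nat \<Rightarrow> 'i \<Rightarrow> 'x \<Rightarrow> 'u::euclidean_space \<Rightarrow> 'x"
    and ell :: "nat \<Rightarrow> 'x \<Rightarrow> 'u \<Rightarrow> real" and \<Phi> :: "'x \<Rightarrow> real" and L c :: real
  assumes subalg: "k \<le> N \<Longrightarrow> subalgebra M (F k)"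
    and filtration: "k < N \<Longrightarrow> subalgebra (F (Suc k)) (F k)"
    and multiplier: "k < N \<Longrightarrow> isometric_multiplier M (F k) (W k i)"
    and adapted: "k < N \<Longrightarrow> W k i \<in> borel_measurable (F (Suc k))"
    and f_C1: "k < N \<Longrightarrow> C1_deriv_le (case_prod (f k i)) (\<lambda>_. L)"
    and ell_C1: "k < N \<Longrightarrow> C1_deriv_le (case_prod (ell k)) (\<lambda>z. c * (1 + norm z))"
    and \<Phi>_C1: "C1_deriv_le \<Phi> (\<lambda>x. c * (1 + norm x))"
begin

definition admissible :: "(nat \<Rightarrow> 'a \<Rightarrow> 'u) \<Rightarrow> bool" where
  "admissible u \<longleftrightarrow> (\<forall>k<N. L2 M (F k) (u k))"

primrec trajectory :: "(nat \<Rightarrow> 'a \<Rightarrow> 'u) \<Rightarrow> nat \<Rightarrow> 'a \<Rightarrow> 'x" where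
  "trajectory u 0 = (\<lambda>\<omega>. x0)"
| "trajectory u (Suc k) = (\<lambda>\<omega>. \<Sum>i\<in>UNIV. W k i \<omega> *\<^sub>R f k i (trajectory u k \<omega>) (u k \<omega>))"

abbreviation deriv_along ::
  "('x \<Rightarrow> 'u \<Rightarrow> 'b::real_normed_vector) \<Rightarrow> (nat \<Rightarrow> 'a \<Rightarrow> 'u) \<Rightarrow> nat \<Rightarrow>
    ('a \<Rightarrow> 'x) \<Rightarrow> ('a \<Rightarrow> 'u) \<Rightarrow> 'a \<Rightarrow> 'b" where
  "deriv_along g u k y v \<omega> \<equiv> fderiv (case_prod g) (trajectory u k \<omega>, u k \<omega>) (y \<omega>, v \<omega>)"

primrec linearized :: "(nat \<Rightarrow> 'a \<Rightarrow> 'u) \<Rightarrow> (nat \<Rightarrow> 'a \<Rightarrow> 'u) \<Rightarrow> nat \<Rightarrow> 'a \<Rightarrow> 'x" where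
  "linearized u v 0 = (\<lambda>\<omega>. 0)"
| "linearized u v (Suc k) = (\<lambda>\<omega>. \<Sum>i\<in>UNIV. W k i \<omega> *\<^sub>R
     deriv_along (f k i) u k (linearized u v k) (v k) \<omega>)"

definition cost_derivative :: "(nat \<Rightarrow> 'a \<Rightarrow> 'u) \<Rightarrow> (nat \<Rightarrow> 'a \<Rightarrow> 'u) \<Rightarrow> real" where
  "cost_derivative u v =
     (\<Sum>k<N. \<integral>\<omega>. deriv_along (ell k) u k (linearized u v k) (v k) \<omega> \<partial>M)
     + (\<integral>\<omega>. fderiv \<Phi> (trajectory u N \<omega>) (linearized u v N \<omega>) \<partial>M)"

lemma finite_measure_M: "finite_measure M"
  by unfold_locales

lemma admissible_L2:
  assumes "admissible u" and k: "k < N"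
  shows "L2 M (F k) (u k)" and "L2 M M (u k)"
  using assms L2_subalgebra[OF subalg[OF less_imp_le[OF k]]] by (auto simp: admissible_def)

lemma L2_noise_sum:
  assumes k: "k < N" and g: "\<And>i. L2 M (F k) (g i)"
  shows "L2 M (F (Suc k)) (\<lambda>\<omega>. \<Sum>i\<in>UNIV. W k i \<omega> *\<^sub>R g i \<omega>)"
  by (intro L2_sum[OF subalg[OF Suc_leI[OF k]]]
      L2_isometric_multiplier[OF multiplier[OF k] adapted[OF k] filtration[OF k] g])

lemma L2_coefficient:
  assumes k: "k < N" and x: "L2 M (F k) x" and u: "L2 M (F k) u"
  shows "L2 M (F k) (\<lambda>\<omega>. f k i (x \<omega>) (u \<omega>))"
  using L2_C1_comp[OF finite_measure_M subalg[OF less_imp_le[OF k]] f_C1[OF k] L2_Pair[OF x u]]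
  by simp

lemma L2_trajectory:
  assumes u: "admissible u"
  shows "k \<le> N \<Longrightarrow> L2 M (F k) (trajectory u k)"
proof (induction k)
  case 0
  show ?case by (simp add: L2_const[OF finite_measure_M])
next
  case (Suc k)
  then have k: "k < N" by simp
  with Suc.IH show ?case
    by (simp add: L2_noise_sum L2_coefficient admissible_L2[OF u])
qed

lemma L2_trajectory_M: "admissible u \<Longrightarrow> k \<le> N \<Longrightarrow> L2 M M (trajectory u k)"
  by (rule L2_subalgebra[OF subalg L2_trajectory])

lemma L2_linearized:
  assumes u: "admissible u" and v: "admissible v"
  shows "k \<le> N \<Longrightarrow> L2 M (F k) (linearized u v k)"
proof (induction k)
  case 0
  show ?case by (simp add: L2_def)
next
  case (Suc k)
  then have k: "k < N" by simp
  then have "L2 M (F k) (\<lambda>\<omega>. deriv_along (f k i) u k (linearized u v k) (v k) \<omega>)" for i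
    using Suc.IH
    by (intro L2_fderiv[OF subalg f_C1] L2_Pair L2_trajectory[OF u] admissible_L2(1)[OF u]
        admissible_L2(1)[OF v]) auto
  with k show ?case by (simp add: L2_noise_sum)
qed

lemma trajectory_tangent:
  assumes t: "step_sizes t"
    and us: "\<And>k. k < N \<Longrightarrow> L2_tangent M (F k) t (\<lambda>j. us j k) (u k) (v k)"
  shows "k \<le> N \<Longrightarrow> L2_tangent M (F k) t (\<lambda>j. trajectory (us j) k) (trajectory u k) (linearized u v k)"
proof (induction k)
  case 0
  show ?case by (simp add: L2_tangent_const L2_const[OF finite_measure_M])
next
  case (Suc k)
  then have k: "k < N" by simp
  note F = subalg[OF less_imp_le[OF k]]
  have "L2_tangent M (F k) t (\<lambda>j \<omega>. (trajectory (us j) k \<omega>, us j k \<omega>))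
      (\<lambda>\<omega>. (trajectory u k \<omega>, u k \<omega>))
      (\<lambda>\<omega>. (linearized u v k \<omega>, v k \<omega>))"
    using Suc.IH k by (intro L2_tangent_Pair[OF F] us) auto
  then have "L2_tangent M (F k) t (\<lambda>j \<omega>. f k i (trajectory (us j) k \<omega>) (us j k \<omega>))
      (\<lambda>\<omega>. f k i (trajectory u k \<omega>) (u k \<omega>))
      (\<lambda>\<omega>. deriv_along (f k i) u k (linearized u v k) (v k) \<omega>)" for i
    using L2_tangent_C1_comp[OF finite_measure_M F f_C1[OF k, of i] t] by fastforce
  then show ?case
    unfolding trajectory.simps linearized.simps
    by (intro L2_tangent_sum[OF subalg[OF Suc.prems]]
        L2_tangent_isometric_multiplier[OF multiplier[OF k] adapted[OF k] F filtration[OF k]])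
qed

lemma
  assumes x: "\<And>k. k \<le> N \<Longrightarrow> L2 M M (x k)" and u: "\<And>k. k < N \<Longrightarrow> L2 M M (u k)"
  shows integrable_cost: "integrable M (\<lambda>\<omega>. (\<Sum>k<N. ell k (x k \<omega>) (u k \<omega>)) + \<Phi> (x N \<omega>))"
    and cost_eq_sum_integrals: "cost M N ell \<Phi> x u
      = (\<Sum>k<N. \<integral>\<omega>. case_prod (ell k) (x k \<omega>, u k \<omega>) \<partial>M) + (\<integral>\<omega>. \<Phi> (x N \<omega>) \<partial>M)"
proof -
  have terminal: "integrable M (\<lambda>\<omega>. \<Phi> (x N \<omega>))"
    by (rule integrable_C1_comp[OF finite_measure_M \<Phi>_C1 x]) simp
  have running: "integrable M (\<lambda>\<omega>. ell k (x k \<omega>) (u k \<omega>))" if k: "k < N" for k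
    using integrable_C1_comp[OF finite_measure_M ell_C1[OF k]
        L2_Pair[OF x[OF less_imp_le[OF k]] u[OF k]]] by simp
  show "integrable M (\<lambda>\<omega>. (\<Sum>k<N. ell k (x k \<omega>) (u k \<omega>)) + \<Phi> (x N \<omega>))"
    by (intro Bochner_Integration.integrable_add Bochner_Integration.integrable_sum terminal
        running) simp
  show "cost M N ell \<Phi> x u = (\<Sum>k<N. \<integral>\<omega>. case_prod (ell k) (x k \<omega>, u k \<omega>) \<partial>M) + (\<integral>\<omega>. \<Phi> (x N \<omega>) \<partial>M)"
    unfolding cost_def using terminal running
    by (subst Bochner_Integration.integral_add) (auto simp: Bochner_Integration.integral_sum)
qed

lemma cost_trajectory:
  assumes u: "admissible u"
  shows "cost M N ell \<Phi> (trajectory u) u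
    = (\<Sum>k<N. \<integral>\<omega>. case_prod (ell k) (trajectory u k \<omega>, u k \<omega>) \<partial>M) + (\<integral>\<omega>. \<Phi> (trajectory u N \<omega>) \<partial>M)"
  by (rule cost_eq_sum_integrals)
    (auto intro: L2_trajectory_M[OF u] admissible_L2(2)[OF u])

lemma cost_quotient_tendsto:
  assumes t: "step_sizes t"
    and us: "\<And>k. k < N \<Longrightarrow> L2_tangent M (F k) t (\<lambda>j. us j k) (u k) (v k)"
  shows "(\<lambda>j. (cost M N ell \<Phi> (trajectory (us j)) (us j) - cost M N ell \<Phi> (trajectory u) u) / t j)
    \<longlonglongrightarrow> cost_derivative u v"
proof -
  have adm: "admissible u" "admissible (us j)" for j
    using L2_tangentD(1)[OF us] L2_tangent_sequence[OF subalg t us] by (auto simp: admissible_def)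
  have x: "L2_tangent M M t (\<lambda>j. trajectory (us j) k) (trajectory u k) (linearized u v k)"
      if "k \<le> N" for k
    by (rule L2_tangent_subalgebra[OF subalg[OF that] trajectory_tangent[OF t us that]])
  have xu: "L2_tangent M M t (\<lambda>j \<omega>. (trajectory (us j) k \<omega>, us j k \<omega>))
      (\<lambda>\<omega>. (trajectory u k \<omega>, u k \<omega>))
      (\<lambda>\<omega>. (linearized u v k \<omega>, v k \<omega>))" if k: "k < N" for k
    using k by (intro L2_tangent_Pair[OF subalgebra_refl] x
        L2_tangent_subalgebra[OF subalg[of k] us]) auto
  have "(\<lambda>j. (\<Sum>k<N. ((\<integral>\<omega>. case_prod (ell k) (trajectory (us j) k \<omega>, us j k \<omega>) \<partial>M)
          - (\<integral>\<omega>. case_prod (ell k) (trajectory u k \<omega>, u k \<omega>) \<partial>M)) / t j)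
        + ((\<integral>\<omega>. \<Phi> (trajectory (us j) N \<omega>) \<partial>M) - (\<integral>\<omega>. \<Phi> (trajectory u N \<omega>) \<partial>M)) / t j)
      \<longlonglongrightarrow> cost_derivative u v"
    unfolding cost_derivative_def
    by (intro tendsto_add tendsto_sum integral_tangent[OF finite_measure_M ell_C1 t xu]
        integral_tangent[OF finite_measure_M \<Phi>_C1 t x[OF order_refl]]) simp_all
  then show ?thesis
    unfolding cost_trajectory[OF adm(1)] cost_trajectory[OF adm(2)]
    by (simp add: sum_divide_distrib[symmetric] sum_subtractf add_diff_add add_divide_distrib)
qed

lemma cost_derivative_nonneg_if_minimal:
  assumes t: "step_sizes t"
    and us: "\<And>k. k < N \<Longrightarrow> L2_tangent M (F k) t (\<lambda>j. us j k) (u k) (v k)"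
    and minimal: "\<forall>\<^sub>F j in sequentially.
      cost M N ell \<Phi> (trajectory u) u \<le> cost M N ell \<Phi> (trajectory (us j)) (us j)"
  shows "0 \<le> cost_derivative u v"
proof (rule tendsto_lowerbound[OF cost_quotient_tendsto[OF t us]])
  show "\<forall>\<^sub>F j in sequentially.
      0 \<le> (cost M N ell \<Phi> (trajectory (us j)) (us j) - cost M N ell \<Phi> (trajectory u) u) / t j"
    using minimal by eventually_elim (simp add: step_sizesD(2)[OF t, THEN less_imp_le])
qed auto

end

section \<open>The adjoint equation\<close>

lemma grad_inner:
  assumes f: "(f has_derivative D) (at x)"
  shows "grad f x \<bullet> h = D h"
proof -
  note linear = has_derivative_linear[OF f]
  have "h = (\<Sum>j\<in>UNIV. (h $ j) *\<^sub>R axis j 1)"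
    by (simp add: vec_eq_iff axis_def if_distrib[of "(*) _"] cong: if_cong)
  then have "D h = (\<Sum>j\<in>UNIV. (h $ j) *\<^sub>R D (axis j 1))"
    using linear_sum[OF linear, of "\<lambda>j. (h $ j) *\<^sub>R axis j 1" UNIV] linear_scale[OF linear] by simp
  then show ?thesis
    using frechet_derivative_at[OF f] by (simp add: grad_def inner_vec_def mult.commute)
qed

lemma grad_nth: "(f has_derivative D) (at x) \<Longrightarrow> grad f x $ j = D (axis j 1)"
  using grad_inner[of f D x "axis j 1"] by (simp add: inner_axis)

locale adjoint_recursion = controlled_recursion M F N W x0 f ell \<Phi> L c
  for M :: "'a measure" and F N and W :: "nat \<Rightarrow> 'i::finite \<Rightarrow> 'a \<Rightarrow> real" and x0 :: "real^'n::finite"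
    and f :: "nat \<Rightarrow> 'i \<Rightarrow> real^'n \<Rightarrow> real^'m::finite \<Rightarrow> real^'n" and ell \<Phi> L c
begin

definition hamiltonian :: "nat \<Rightarrow> real^'n \<Rightarrow> ('i \<Rightarrow> real^'n) \<Rightarrow> real^'m \<Rightarrow> real" where
  "hamiltonian k x r u = ell k x u + (\<Sum>i\<in>UNIV. r i \<bullet> f k i x u)"

definition hamiltonian_gradx :: "nat \<Rightarrow> real^'n \<Rightarrow> ('i \<Rightarrow> real^'n) \<Rightarrow> real^'m \<Rightarrow> real^'n" where
  "hamiltonian_gradx k x r u = grad (\<lambda>x'. hamiltonian k x' r u) x"

definition hamiltonian_gradu :: "nat \<Rightarrow> real^'n \<Rightarrow> ('i \<Rightarrow> real^'n) \<Rightarrow> real^'m \<Rightarrow> real^'m" where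
  "hamiltonian_gradu k x r u = grad (\<lambda>u'. hamiltonian k x r u') u"

definition hamiltonian_deriv ::
  "nat \<Rightarrow> real^'n \<Rightarrow> ('i \<Rightarrow> real^'n) \<Rightarrow> real^'m \<Rightarrow> (real^'n) \<times> (real^'m) \<Rightarrow> real" where
  "hamiltonian_deriv k x r u y =
     fderiv (case_prod (ell k)) (x, u) y + (\<Sum>i\<in>UNIV. r i \<bullet> fderiv (case_prod (f k i)) (x, u) y)"

lemma has_derivative_hamiltonian:
  assumes k: "k < N"
  shows "((\<lambda>(x, u). hamiltonian k x r u) has_derivative hamiltonian_deriv k x r u) (at (x, u))"
proof -
  have "((\<lambda>z. case_prod (ell k) z + (\<Sum>i\<in>UNIV. r i \<bullet> case_prod (f k i) z)) has_derivative
      hamiltonian_deriv k x r u) (at (x, u))"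
    unfolding hamiltonian_deriv_def
    by (intro has_derivative_add has_derivative_sum has_derivative_inner_right
        C1_deriv_leD(2)[OF ell_C1[OF k]] C1_deriv_leD(2)[OF f_C1[OF k]])
  then show ?thesis by (simp add: hamiltonian_def case_prod_unfold)
qed

lemma has_derivative_hamiltonian_slices:
  assumes k: "k < N"
  shows "((\<lambda>x'. hamiltonian k x' r u) has_derivative (\<lambda>h. hamiltonian_deriv k x r u (h, 0))) (at x)"
    and "((\<lambda>u'. hamiltonian k x r u') has_derivative (\<lambda>h. hamiltonian_deriv k x r u (0, h))) (at u)"
  using has_derivative_slices[OF has_derivative_hamiltonian[OF k]] by simp_all

lemma hamiltonian_grad_inner:
  assumes k: "k < N"
  shows "hamiltonian_gradx k x r u \<bullet> h + hamiltonian_gradu k x r u \<bullet> v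
      = hamiltonian_deriv k x r u (h, v)"
proof -
  have "hamiltonian_gradx k x r u \<bullet> h + hamiltonian_gradu k x r u \<bullet> v
      = hamiltonian_deriv k x r u (h, 0) + hamiltonian_deriv k x r u (0, v)"
    unfolding hamiltonian_gradx_def hamiltonian_gradu_def
    using has_derivative_hamiltonian_slices[OF k, THEN grad_inner] by metis
  also have "\<dots> = hamiltonian_deriv k x r u (h, v)"
    using linear_add[OF has_derivative_linear[OF has_derivative_hamiltonian[OF k]],
        of x r u "(h, 0)" "(0, v)"]
    by simp
  finally show ?thesis .
qed

lemma
  assumes k: "k < N" and x: "L2 M M x" and u: "L2 M M u" and r: "\<And>i. L2 M M (r i)"
  shows L2_hamiltonian_gradx: "L2 M M (\<lambda>\<omega>. hamiltonian_gradx k (x \<omega>) (\<lambda>i. r i \<omega>) (u \<omega>))"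
    and L2_hamiltonian_gradu: "L2 M M (\<lambda>\<omega>. hamiltonian_gradu k (x \<omega>) (\<lambda>i. r i \<omega>) (u \<omega>))"
proof -
  note subalg_M = subalgebra_refl[of M] and xu = L2_Pair[OF x u]
  have "L2 M M (\<lambda>\<omega>. hamiltonian_deriv k (x \<omega>) (\<lambda>i. r i \<omega>) (u \<omega>) h)" for h
    unfolding hamiltonian_deriv_def
    by (intro L2_add[OF subalg_M] L2_sum[OF subalg_M]
        L2_fderiv_direction[OF finite_measure_M subalg_M ell_C1[OF k] xu]
        L2_inner_fderiv_direction[OF subalg_M f_C1[OF k] xu] r)
  then show "L2 M M (\<lambda>\<omega>. hamiltonian_gradx k (x \<omega>) (\<lambda>i. r i \<omega>) (u \<omega>))"
    and "L2 M M (\<lambda>\<omega>. hamiltonian_gradu k (x \<omega>) (\<lambda>i. r i \<omega>) (u \<omega>))"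
    by (auto intro!: L2_componentwise simp: hamiltonian_gradx_def hamiltonian_gradu_def
        has_derivative_hamiltonian_slices[OF k, THEN grad_nth])
qed

lemma L2_grad_terminal_cost:
  assumes "L2 M M x"
  shows "L2 M M (\<lambda>\<omega>. grad \<Phi> (x \<omega>))"
  using L2_fderiv_direction[OF finite_measure_M subalgebra_refl \<Phi>_C1 assms]
  by (auto intro!: L2_componentwise simp: grad_nth[OF C1_deriv_leD(2)[OF \<Phi>_C1]])

text \<open>The costate is determined backwards: \<open>costate_backward u j\<close> is its value at time \<open>N - j\<close>.\<close>
primrec costate_backward :: "(nat \<Rightarrow> 'a \<Rightarrow> real^'m) \<Rightarrow> nat \<Rightarrow> 'a \<Rightarrow> real^'n" where
  "costate_backward u 0 = (\<lambda>\<omega>. grad \<Phi> (trajectory u N \<omega>))"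
| "costate_backward u (Suc j) = (let k = N - Suc j in (\<lambda>\<omega>. hamiltonian_gradx k (trajectory u k \<omega>)
     (\<lambda>i. cond_exp_vec M (F k) (\<lambda>\<omega>'. W k i \<omega>' *\<^sub>R costate_backward u j \<omega>') \<omega>) (u k \<omega>)))"

definition costate :: "(nat \<Rightarrow> 'a \<Rightarrow> real^'m) \<Rightarrow> nat \<Rightarrow> 'a \<Rightarrow> real^'n" where
  "costate u k = costate_backward u (N - k)"

definition adjoint :: "(nat \<Rightarrow> 'a \<Rightarrow> real^'m) \<Rightarrow> nat \<Rightarrow> 'i \<Rightarrow> 'a \<Rightarrow> real^'n" where
  "adjoint u k i = cond_exp_vec M (F k) (\<lambda>\<omega>. W k i \<omega> *\<^sub>R costate u (Suc k) \<omega>)"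

lemma costate_terminal: "costate u N \<omega> = grad \<Phi> (trajectory u N \<omega>)"
  by (simp add: costate_def)

lemma costate_step:
  assumes "k < N"
  shows "costate u k \<omega> = hamiltonian_gradx k (trajectory u k \<omega>) (\<lambda>i. adjoint u k i \<omega>) (u k \<omega>)"
proof -
  have "N - k = Suc (N - Suc k)" "N - Suc (N - Suc k) = k" using assms by auto
  then show ?thesis by (simp add: costate_def adjoint_def)
qed

lemma finite_measure_subalgebra_F: "k \<le> N \<Longrightarrow> finite_measure_subalgebra M (F k)"
  using subalg
  by (intro finite_measure_subalgebra.intro finite_measure_subalgebra_axioms.intro finite_measure_M)

lemma L2_adjoint_if_L2_costate:
  assumes k: "k < N" and costate: "L2 M M (costate u (Suc k))"
  shows "L2 M (F k) (adjoint u k i)"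
  unfolding adjoint_def
  by (rule finite_measure_subalgebra.L2_cond_exp_vec_isometric_multiplier[
        OF finite_measure_subalgebra_F[OF less_imp_le[OF k]] multiplier[OF k] costate])

lemma L2_costate:
  assumes u: "admissible u"
  shows "k \<le> N \<Longrightarrow> L2 M M (costate u k)"
proof (induction k rule: inc_induct)
  case base
  have "L2 M M (\<lambda>\<omega>. grad \<Phi> (trajectory u N \<omega>))"
    by (intro L2_grad_terminal_cost L2_trajectory_M[OF u] order_refl)
  then show ?case by (simp add: costate_terminal[abs_def])
next
  case (step k)
  note F = L2_subalgebra[OF subalg[OF less_imp_le[OF step(2)]]]
  have "L2 M M (\<lambda>\<omega>. hamiltonian_gradx k (trajectory u k \<omega>) (\<lambda>i. adjoint u k i \<omega>) (u k \<omega>))"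
    using step(2) by (intro L2_hamiltonian_gradx F L2_trajectory[OF u] admissible_L2(1)[OF u]
        L2_adjoint_if_L2_costate step.IH) auto
  then show ?case by (simp add: costate_step[OF step(2), abs_def])
qed

lemma L2_adjoint:
  assumes u: "admissible u" and k: "k < N"
  shows "L2 M (F k) (adjoint u k i)" and "L2 M M (adjoint u k i)"
proof -
  show "L2 M (F k) (adjoint u k i)"
    using k by (intro L2_adjoint_if_L2_costate L2_costate[OF u]) auto
  then show "L2 M M (adjoint u k i)"
    by (rule L2_subalgebra[OF subalg[OF less_imp_le[OF k]]])
qed

lemma adjoint_cong_AE:
  assumes u: "admissible u" and k: "k < N" and G: "G \<in> borel_measurable M"
    and AE_eq: "AE \<omega> in M. costate u (Suc k) \<omega> = G \<omega>"
  shows "AE \<omega> in M. adjoint u k i \<omega> = cond_exp_vec M (F k) (\<lambda>\<omega>. W k i \<omega> *\<^sub>R G \<omega>) \<omega>"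
  unfolding adjoint_def
proof (rule cond_exp_vec_cong_AE)
  show "sigma_finite_subalgebra M (F k)"
    using k by (intro finite_measure_subalgebra_is_sigma_finite finite_measure_subalgebra_F) simp
  note [measurable] = isometric_multiplierD(1)[OF multiplier[OF k, of i]]
    L2_measurable[OF L2_costate[OF u Suc_leI[OF k]]] G
  show "(\<lambda>\<omega>. W k i \<omega> *\<^sub>R costate u (Suc k) \<omega>) \<in> borel_measurable M" by measurable
  show "(\<lambda>\<omega>. W k i \<omega> *\<^sub>R G \<omega>) \<in> borel_measurable M" by measurable
qed (use AE_eq in auto)

definition cost_gradient :: "(nat \<Rightarrow> 'a \<Rightarrow> real^'m) \<Rightarrow> nat \<Rightarrow> 'a \<Rightarrow> real^'m" where
  "cost_gradient u k \<omega> = hamiltonian_gradu k (trajectory u k \<omega>) (\<lambda>i. adjoint u k i \<omega>) (u k \<omega>)"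

lemma L2_cost_gradient:
  assumes u: "admissible u" and k: "k < N"
  shows "L2 M M (cost_gradient u k)"
proof -
  note L2_hamiltonian_gradu[OF k L2_trajectory_M[OF u less_imp_le[OF k]] admissible_L2(2)[OF u k]
      L2_adjoint(2)[OF u k]]
  then show ?thesis by (simp add: cost_gradient_def[abs_def])
qed

lemma integral_costate_inner_linearized_Suc:
  assumes u: "admissible u" and v: "admissible v" and k: "k < N"
  shows "(\<integral>\<omega>. costate u (Suc k) \<omega> \<bullet> linearized u v (Suc k) \<omega> \<partial>M)
    = (\<integral>\<omega>. (\<Sum>i\<in>UNIV. adjoint u k i \<omega> \<bullet>
        deriv_along (f k i) u k (linearized u v k) (v k) \<omega>) \<partial>M)"
proof -
  interpret Fk: finite_measure_subalgebra M "F k"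
    using k by (intro finite_measure_subalgebra_F) simp
  let ?D = "\<lambda>i \<omega>. deriv_along (f k i) u k (linearized u v k) (v k) \<omega>"
  have costate: "L2 M M (costate u (Suc k))" using k by (intro L2_costate[OF u]) simp
  have L2_D: "L2 M (F k) (?D i)" for i
    using k by (intro L2_fderiv[OF Fk.subalg f_C1] L2_Pair L2_trajectory[OF u] L2_linearized[OF u v]
        admissible_L2(1)[OF u] admissible_L2(1)[OF v]) auto
  have L2_WD: "L2 M M (\<lambda>\<omega>. W k i \<omega> *\<^sub>R ?D i \<omega>)" for i
    by (rule L2_isometric_multiplier[OF multiplier[OF k]
        isometric_multiplierD(1)[OF multiplier[OF k]] Fk.subalg L2_D])
  have "(\<integral>\<omega>. costate u (Suc k) \<omega> \<bullet> linearized u v (Suc k) \<omega> \<partial>M)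
      = (\<integral>\<omega>. (\<Sum>i\<in>UNIV. costate u (Suc k) \<omega> \<bullet> (W k i \<omega> *\<^sub>R ?D i \<omega>)) \<partial>M)"
    by (simp add: inner_sum_right)
  also have "\<dots> = (\<Sum>i\<in>UNIV. \<integral>\<omega>. costate u (Suc k) \<omega> \<bullet> (W k i \<omega> *\<^sub>R ?D i \<omega>) \<partial>M)"
    by (intro Bochner_Integration.integral_sum integrable_inner_L2 costate L2_WD)
  also have "\<dots> = (\<Sum>i\<in>UNIV. \<integral>\<omega>. adjoint u k i \<omega> \<bullet> ?D i \<omega> \<partial>M)"
    unfolding adjoint_def
    by (simp only: Fk.integral_cond_exp_vec_isometric_multiplier[OF multiplier[OF k] costate L2_D])
  also have "\<dots> = (\<integral>\<omega>. (\<Sum>i\<in>UNIV. adjoint u k i \<omega> \<bullet> ?D i \<omega>) \<partial>M)"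
    by (intro Bochner_Integration.integral_sum[symmetric] integrable_inner_L2
        L2_subalgebra[OF Fk.subalg L2_D] L2_adjoint(2)[OF u k])
  finally show ?thesis .
qed

lemma costate_linearized_increment:
  assumes u: "admissible u" and v: "admissible v" and k: "k < N"
  shows "(\<integral>\<omega>. costate u (Suc k) \<omega> \<bullet> linearized u v (Suc k) \<omega> \<partial>M)
      - (\<integral>\<omega>. costate u k \<omega> \<bullet> linearized u v k \<omega> \<partial>M)
    = (\<integral>\<omega>. cost_gradient u k \<omega> \<bullet> v k \<omega> \<partial>M)
      - (\<integral>\<omega>. deriv_along (ell k) u k (linearized u v k) (v k) \<omega> \<partial>M)"
proof -
  let ?l = "\<lambda>\<omega>. deriv_along (ell k) u k (linearized u v k) (v k) \<omega>"
  have x: "L2 M M (trajectory u k)" and y: "L2 M M (linearized u v k)"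
    by (intro L2_trajectory_M[OF u] L2_subalgebra[OF subalg[of k] L2_linearized[OF u v]]
        less_imp_le[OF k])+
  have integrable: "integrable M (\<lambda>\<omega>. costate u k \<omega> \<bullet> linearized u v k \<omega>)"
    "integrable M (\<lambda>\<omega>. cost_gradient u k \<omega> \<bullet> v k \<omega>)" "integrable M ?l"
    by (intro integrable_inner_L2 L2_costate[OF u] L2_cost_gradient[OF u]
        integrable_fderiv[OF finite_measure_M ell_C1]
        L2_Pair x y admissible_L2(2)[OF u] admissible_L2(2)[OF v] k less_imp_le[OF k])+
  have "(\<Sum>i\<in>UNIV. adjoint u k i \<omega> \<bullet>
        deriv_along (f k i) u k (linearized u v k) (v k) \<omega>)
      = costate u k \<omega> \<bullet> linearized u v k \<omega> + cost_gradient u k \<omega> \<bullet> v k \<omega> - ?l \<omega>" for \<omega>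
    using hamiltonian_grad_inner[OF k]
    by (simp add: costate_step[OF k] cost_gradient_def hamiltonian_deriv_def)
  then show ?thesis
    unfolding integral_costate_inner_linearized_Suc[OF u v k] using integrable by simp
qed

lemma cost_derivative_eq_integral_cost_gradient:
  assumes u: "admissible u" and v: "admissible v"
  shows "cost_derivative u v = (\<integral>\<omega>. (\<Sum>k<N. cost_gradient u k \<omega> \<bullet> v k \<omega>) \<partial>M)"
proof -
  let ?a = "\<lambda>k. \<integral>\<omega>. costate u k \<omega> \<bullet> linearized u v k \<omega> \<partial>M"
  have "(\<integral>\<omega>. fderiv \<Phi> (trajectory u N \<omega>) (linearized u v N \<omega>) \<partial>M) = ?a N - ?a 0"
    by (simp add: costate_terminal grad_inner[OF C1_deriv_leD(2)[OF \<Phi>_C1]])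
  also have "\<dots> = (\<Sum>k<N. ?a (Suc k) - ?a k)" by (rule sum_lessThan_telescope[symmetric])
  also have "\<dots> = (\<Sum>k<N. (\<integral>\<omega>. cost_gradient u k \<omega> \<bullet> v k \<omega> \<partial>M)
      - (\<integral>\<omega>. deriv_along (ell k) u k (linearized u v k) (v k) \<omega> \<partial>M))"
    by (intro sum.cong refl costate_linearized_increment u v) simp
  finally have "cost_derivative u v = (\<Sum>k<N. \<integral>\<omega>. cost_gradient u k \<omega> \<bullet> v k \<omega> \<partial>M)"
    by (simp add: cost_derivative_def sum_subtractf)
  also have "\<dots> = (\<integral>\<omega>. (\<Sum>k<N. cost_gradient u k \<omega> \<bullet> v k \<omega>) \<partial>M)"
    by (intro Bochner_Integration.integral_sum[symmetric] integrable_inner_L2 L2_cost_gradient[OF u]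
        admissible_L2(2)[OF v]) auto
  finally show ?thesis .
qed

end

section \<open>The filtration generated by the noise\<close>

lemma space_filt: "space (filt M w k) = space M"
  unfolding filt_def by (rule space_measure_of) auto

lemma sets_vimage_algebra_borel:
  "sets (vimage_algebra S f borel) = {f -` A \<inter> S | A. A \<in> sets borel}"
  by (rule sets_vimage_algebra2) simp

lemma sets_filt:
  "sets (filt M w k)
    = sigma_sets (space M) (\<Union>j\<in>{1..k}. sets (vimage_algebra (space M) (w j) borel))"
proof -
  have "{w j -` A \<inter> space M | j A. j \<in> {1..k} \<and> A \<in> sets borel}
      = (\<Union>j\<in>{1..k}. sets (vimage_algebra (space M) (w j) borel))"
    unfolding sets_vimage_algebra_borel by blast
  then show ?thesis unfolding filt_def by (subst sets_measure_of) auto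
qed

lemma subalgebra_filt:
  assumes "\<And>j. j \<in> {1..k} \<Longrightarrow> w j \<in> borel_measurable M"
  shows "subalgebra M (filt M w k)"
  unfolding subalgebra_def space_filt sets_filt
  using assms
  by (auto intro!: sets.sigma_sets_subset measurable_sets simp: sets_vimage_algebra_borel)

lemma subalgebra_filt_mono: "j \<le> k \<Longrightarrow> subalgebra (filt M w k) (filt M w j)"
  unfolding subalgebra_def space_filt sets_filt
  by (intro conjI refl sigma_sets_mono' UN_mono) auto

lemma measurable_filt: "j \<in> {1..k} \<Longrightarrow> w j \<in> borel_measurable (filt M w k)"
  by (rule measurableI)
    (simp_all only: space_filt sets_filt sets_vimage_algebra_borel space_borel UNIV_I,
      blast intro: sigma_sets.Basic)

context prob_space
begin

lemma indep_var_if_indep_set: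
  assumes G: "subalgebra M G" "X \<in> measurable G S" and H: "subalgebra M H" "Y \<in> measurable H T"
    and indep: "indep_set (sets G) (sets H)"
  shows "indep_var S X T Y"
proof -
  have "indep_set (sigma_sets (space M) {X -` A \<inter> space M | A. A \<in> sets S})
      (sigma_sets (space M) {Y -` A \<inter> space M | A. A \<in> sets T})"
    using indep unfolding indep_set_def
  proof (rule indep_sets_mono_sets)
    have space: "space G = space M" "space H = space M"
      using G(1) H(1) by (auto simp: subalgebra_def)
    then have "{X -` A \<inter> space M | A. A \<in> sets S} \<subseteq> sets G"
      "{Y -` A \<inter> space M | A. A \<in> sets T} \<subseteq> sets H"
      using measurable_sets[OF G(2)] measurable_sets[OF H(2)] by auto
    then have "sigma_sets (space M) {X -` A \<inter> space M | A. A \<in> sets S} \<subseteq> sets G"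
      and "sigma_sets (space M) {Y -` A \<inter> space M | A. A \<in> sets T} \<subseteq> sets H"
      using sets.sigma_sets_subset[of _ G] sets.sigma_sets_subset[of _ H] space by simp_all
    then show "case_bool (sigma_sets (space M) {X -` A \<inter> space M | A. A \<in> sets S})
        (sigma_sets (space M) {Y -` A \<inter> space M | A. A \<in> sets T}) i
            \<subseteq> case_bool (sets G) (sets H) i" for i
      by (cases i) auto
  qed
  then show ?thesis
    using measurable_from_subalg[OF G] measurable_from_subalg[OF H] by (simp add: indep_var_eq)
qed

lemma indep_set_filt:
  assumes indep: "indep_vars (\<lambda>_. borel) w {1..N}" and k: "k < N"
  shows "indep_set (sets (filt M w k)) (sets (vimage_algebra (space M) (w (Suc k)) borel))"
proof -
  let ?E = "\<lambda>j. sets (vimage_algebra (space M) (w j) borel)"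
  let ?I = "case_bool {1..k} {Suc k}"
  have indep_generators: "indep_sets ?E {1..N}"
    using indep by (simp add: indep_vars_def2 sets_vimage_algebra_borel)
  have "indep_sets (\<lambda>i. sigma_sets (space M) (\<Union>j\<in>?I i. ?E j)) UNIV"
  proof (rule indep_sets_collect_sigma)
    show "indep_sets ?E (\<Union>i\<in>UNIV. ?I i)"
      by (rule indep_sets_mono_index[OF _ indep_generators]) (use k in \<open>auto split: bool.splits\<close>)
    show "disjoint_family_on ?I UNIV"
      by (auto simp: disjoint_family_on_def split: bool.splits)
  qed (rule sets.Int_stable)
  moreover have "sigma_sets (space M) (\<Union>j\<in>?I i. ?E j)
      = case_bool (sets (filt M w k)) (?E (Suc k)) i" for i
    using sets.sigma_sets_eq[of "vimage_algebra (space M) (w (Suc k)) borel"]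
    by (cases i) (simp_all add: sets_filt)
  ultimately show ?thesis by (simp add: indep_set_def)
qed

lemma isometric_multiplier_noise:
  fixes w :: "nat \<Rightarrow> 'a \<Rightarrow> real^'d::finite"
  assumes indep: "indep_vars (\<lambda>_. borel) w {1..N}" and k: "k < N"
    and var: "integrable M (\<lambda>\<omega>. (w (Suc k) \<omega> $ i)\<^sup>2)" "(\<integral>\<omega>. (w (Suc k) \<omega> $ i)\<^sup>2 \<partial>M) = 1"
  shows "isometric_multiplier M (filt M w k) (\<lambda>\<omega>. w (Suc k) \<omega> $ i)"
  unfolding isometric_multiplier_def
proof (intro conjI allI impI; (elim conjE)?)
  have w: "w j \<in> borel_measurable M" if "j \<in> {1..N}" for j
    using indep that by (auto simp: indep_vars_def2)
  show "(\<lambda>\<omega>. w (Suc k) \<omega> $ i) \<in> borel_measurable M"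
    by (rule measurable_compose[OF w borel_measurable_vec_nth]) (use k in simp)
  fix g :: "'a \<Rightarrow> real" assume g: "g \<in> borel_measurable (filt M w k)" "integrable M g"
  have indep_g_w: "indep_var borel g borel (\<lambda>\<omega>. (w (Suc k) \<omega> $ i)\<^sup>2)"
  proof (rule indep_var_if_indep_set)
    let ?H = "vimage_algebra (space M) (w (Suc k)) borel"
    show "indep_set (sets (filt M w k)) (sets ?H)" by (rule indep_set_filt[OF indep k])
    show "subalgebra M (filt M w k)" by (rule subalgebra_filt) (use w k in auto)
    show "subalgebra M ?H"
      using w[of "Suc k"] k
      by (auto simp: subalgebra_def sets_vimage_algebra_borel intro: measurable_sets)
    have "w (Suc k) \<in> measurable ?H borel" by (rule measurable_vimage_algebra1) simp
    from measurable_compose[OF this borel_measurable_vec_nth]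
    show "(\<lambda>\<omega>. (w (Suc k) \<omega> $ i)\<^sup>2) \<in> borel_measurable ?H"
      by simp
  qed (rule g)
  show "integrable M (\<lambda>\<omega>. (w (Suc k) \<omega> $ i)\<^sup>2 * g \<omega>)"
    using indep_var_integrable[OF indep_g_w g(2) var(1)] by (simp add: mult.commute)
  show "(\<integral>\<omega>. (w (Suc k) \<omega> $ i)\<^sup>2 * g \<omega> \<partial>M) = (\<integral>\<omega>. g \<omega> \<partial>M)"
    using indep_var_lebesgue_integral[OF indep_g_w g(2) var(1)] var(2) by (simp add: mult.commute)
qed

end

section \<open>Tangent cones\<close>

lemma ctrl_set_adm: "ctrl_set M w N U \<Longrightarrow> u \<in> U \<Longrightarrow> adm M w N u"
  unfolding ctrl_set_def by (elim conjE) (erule bspec)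

lemma L2norm_le_cdist: "k < N \<Longrightarrow> L2norm M (\<lambda>\<omega>. u k \<omega> - v k \<omega>) \<le> cdist M N u v"
  unfolding cdist_def
  by (rule member_le_sum[of k "{..<N}" "\<lambda>k. L2norm M (\<lambda>\<omega>. u k \<omega> - v k \<omega>)"])
    (auto simp: L2norm_nonneg)

lemma distU_less_imp_ex:
  assumes "u \<in> U" and "distU M N U z < e"
  obtains u' where "u' \<in> U" "cdist M N z u' < e"
proof -
  have "{cdist M N z u | u. u \<in> U} \<noteq> {}" using assms(1) by blast
  from cInf_lessD[OF this assms(2)[unfolded distU_def]] show thesis using that by blast
qed

lemma clarke_cone_subset_contingent_cone:
  assumes u: "u \<in> U"
  shows "clarke_cone M w N U u \<subseteq> contingent_cone M w N U u"
proof
  fix v assume v: "v \<in> clarke_cone M w N U u"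
  have "((\<lambda>t. distU M N U (addc u t v) / t) \<longlongrightarrow> 0) (at_right 0)"
  proof (rule tendstoI)
    fix e :: real assume e_pos: "0 < e"
    have "cdist M N u u = 0" by (simp add: cdist_def L2norm_zero)
    with v u e_pos obtain d where "d > 0" "\<And>t. 0 < t \<Longrightarrow> t < d \<Longrightarrow> \<bar>distU M N U (addc u t v) / t\<bar> < e"
      unfolding clarke_cone_def by fastforce
    then show "\<forall>\<^sub>F t in at_right 0. dist (distU M N U (addc u t v) / t) 0 < e"
      by (intro eventually_at_rightI[of 0 d]) (auto simp: dist_real_def)
  qed
  then have "((\<lambda>t. ereal (distU M N U (addc u t v) / t)) \<longlongrightarrow> ereal 0) (at_right 0)"
    by (rule tendsto_ereal)
  then have "Liminf (at_right 0) (\<lambda>t. ereal (distU M N U (addc u t v) / t)) = ereal 0"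
    by (intro lim_imp_Liminf trivial_limit_at_right_real)
  with v show "v \<in> contingent_cone M w N U u"
    by (simp add: clarke_cone_def contingent_cone_def)
qed

lemma contingent_cone_ex_step:
  assumes v: "v \<in> contingent_cone M w N U u" and e_pos: "0 < e"
  shows "\<exists>t. 0 < t \<and> t < e \<and> distU M N U (addc u t v) < t * e"
proof (rule ccontr)
  assume no_step: "\<not> ?thesis"
  then have "e \<le> distU M N U (addc u t v) / t" if "0 < t" "t < e" for t
  proof -
    from no_step that have "t * e \<le> distU M N U (addc u t v)" by (meson not_le)
    with that show ?thesis by (simp add: pos_le_divide_eq mult.commute)
  qed
  then have "\<forall>\<^sub>F t in at_right 0. ereal e \<le> ereal (distU M N U (addc u t v) / t)"
    using e_pos by (intro eventually_at_rightI[of 0 e]) auto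
  then have "ereal e \<le> Liminf (at_right 0) (\<lambda>t. ereal (distU M N U (addc u t v) / t))"
    by (rule Liminf_bounded)
  with v e_pos show False by (simp add: contingent_cone_def)
qed

lemma L2_tangent_if_cdist_small:
  assumes F: "subalgebra M (filt M w k)" and k: "k < N"
    and adm: "adm M w N u" "adm M w N v" "\<And>j. adm M w N (us j)"
    and t_pos: "\<And>j. 0 < t j" and e_null: "e \<longlonglongrightarrow> 0"
    and cdist_le: "\<And>j. cdist M N (addc u (t j) v) (us j) \<le> t j * e j"
  shows "L2_tangent M (filt M w k) t (\<lambda>j. us j k) (u k) (v k)"
proof -
  have L2: "L2 M (filt M w k) (u k)" "L2 M (filt M w k) (v k)" "L2 M (filt M w k) (us j k)" for j
    using adm k by (auto simp: adm_def)
  have "L2_tendsto M (filt M w k) (\<lambda>j \<omega>. (us j k \<omega> - u k \<omega>) /\<^sub>R t j) (v k)"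
  proof (rule L2_tendsto_squeeze[OF _ L2(2) e_null])
    show "L2 M (filt M w k) (\<lambda>\<omega>. (us j k \<omega> - u k \<omega>) /\<^sub>R t j)" for j
      by (intro L2_scaleR L2_diff[OF F] L2)
    show "L2norm M (\<lambda>\<omega>. (us j k \<omega> - u k \<omega>) /\<^sub>R t j - v k \<omega>) \<le> e j" for j
    proof -
      have "(us j k \<omega> - u k \<omega>) /\<^sub>R t j - v k \<omega>
          = (- inverse (t j)) *\<^sub>R (addc u (t j) v k \<omega> - us j k \<omega>)" for \<omega>
        using t_pos[of j] by (simp add: addc_def algebra_simps)
      then have "L2norm M (\<lambda>\<omega>. (us j k \<omega> - u k \<omega>) /\<^sub>R t j - v k \<omega>)
          = inverse (t j) * L2norm M (\<lambda>\<omega>. addc u (t j) v k \<omega> - us j k \<omega>)"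
        using t_pos[of j] by (simp only: L2norm_scaleR) simp
      also have "\<dots> \<le> inverse (t j) * (t j * e j)"
        using t_pos[of j]
        by (intro mult_left_mono order_trans[OF L2norm_le_cdist[OF k] cdist_le]) auto
      also have "\<dots> = e j" using t_pos[of j] by simp
      finally show ?thesis .
    qed
  qed
  with L2(1) show ?thesis by (simp add: L2_tangent_def)
qed

lemma contingent_cone_tangent_sequence:
  assumes F: "\<And>k. k < N \<Longrightarrow> subalgebra M (filt M w k)"
    and U: "ctrl_set M w N U" and u: "u \<in> U" and v: "v \<in> contingent_cone M w N U u"
  obtains t us where "step_sizes t" "\<And>j. us j \<in> U"
    "\<And>k. k < N \<Longrightarrow> L2_tangent M (filt M w k) t (\<lambda>j. us j k) (u k) (v k)"
proof -
  define e where "e j = inverse (real (Suc j))" for j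
  have e: "e \<longlonglongrightarrow> 0" "0 < e j" "e j \<le> 1" for j
    using LIMSEQ_inverse_real_of_nat by (simp_all add: e_def[abs_def] field_simps)
  have "\<forall>j. \<exists>t u'. 0 < t \<and> t < e j \<and> u' \<in> U \<and> cdist M N (addc u t v) u' < t * e j"
  proof
    fix j
    obtain t where t: "0 < t" "t < e j" "distU M N U (addc u t v) < t * e j"
      using contingent_cone_ex_step[OF v e(2)] by blast
    obtain u' where "u' \<in> U" "cdist M N (addc u t v) u' < t * e j"
      by (rule distU_less_imp_ex[OF u t(3)])
    with t show "\<exists>t u'. 0 < t \<and> t < e j \<and> u' \<in> U \<and> cdist M N (addc u t v) u' < t * e j" by blast
  qed
  then obtain t us where t: "\<And>j. 0 < t j" "\<And>j. t j < e j" and us: "\<And>j. us j \<in> U"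
    and cdist_less: "\<And>j. cdist M N (addc u (t j) v) (us j) < t j * e j" by metis
  have "t \<longlonglongrightarrow> 0"
    by (rule tendsto_sandwich[OF _ _ tendsto_const e(1)])
      (auto intro!: always_eventually less_imp_le t)
  then have "step_sizes t"
    using t(1) order_trans[OF less_imp_le[OF t(2)] e(3)] by (simp add: step_sizes_def)
  moreover have "adm M w N v" using v by (simp add: contingent_cone_def)
  then have "L2_tangent M (filt M w k) t (\<lambda>j. us j k) (u k) (v k)" if "k < N" for k
    using that by (intro L2_tangent_if_cdist_small[OF F _ ctrl_set_adm[OF U u] _
        ctrl_set_adm[OF U us] t(1) e(1)
        less_imp_le[OF cdist_less]])
  ultimately show thesis using us that by blast
qed

section \<open>The stochastic control problem\<close>

text \<open>The drift is treated as the coefficient of a noise that is constantly \<open>1\<close>, with index \<open>None\<close>.\<close>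
definition noise_weight :: "(nat \<Rightarrow> 'a \<Rightarrow> real^'d) \<Rightarrow> nat \<Rightarrow> 'd option \<Rightarrow> 'a \<Rightarrow> real" where
  "noise_weight w k i \<omega> = (case i of None \<Rightarrow> 1 | Some i \<Rightarrow> w (Suc k) \<omega> $ i)"

definition noise_coefficient ::
  "(nat \<Rightarrow> 'x \<Rightarrow> 'u \<Rightarrow> 'b) \<Rightarrow> (nat \<Rightarrow> 'x \<Rightarrow> 'u \<Rightarrow> 'b^'d) \<Rightarrow> nat \<Rightarrow> 'd option \<Rightarrow> 'x \<Rightarrow> 'u \<Rightarrow> 'b" where
  "noise_coefficient b \<sigma> k i x u = (case i of None \<Rightarrow> b k x u | Some i \<Rightarrow> \<sigma> k x u $ i)"

lemma sum_UNIV_option: "(\<Sum>i\<in>UNIV. g i) = g None + (\<Sum>i\<in>UNIV. g (Some i))"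
  for g :: "'d::finite option \<Rightarrow> 'b::comm_monoid_add"
  by (simp add: UNIV_option_conv sum.reindex)

locale stochastic_control = prob_space M for M :: "'a measure" +
  fixes w :: "nat \<Rightarrow> 'a \<Rightarrow> real^'d::finite" and N :: nat and x0 :: "real^'n::finite"
    and b :: "nat \<Rightarrow> real^'n \<Rightarrow> real^'m::finite \<Rightarrow> real^'n"
    and \<sigma> :: "nat \<Rightarrow> real^'n \<Rightarrow> real^'m \<Rightarrow> real^'n^'d"
    and ell :: "nat \<Rightarrow> real^'n \<Rightarrow> real^'m \<Rightarrow> real" and \<Phi> :: "real^'n \<Rightarrow> real" and L c :: real
  assumes w_indep: "indep_vars (\<lambda>_. borel) w {1..N}"
    and w_square_integrable: "k < N \<Longrightarrow> integrable M (\<lambda>\<omega>. (w (Suc k) \<omega> $ i)\<^sup>2)"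
    and w_variance: "k < N \<Longrightarrow> (\<integral>\<omega>. (w (Suc k) \<omega> $ i)\<^sup>2 \<partial>M) = 1"
    and b_C1: "k < N \<Longrightarrow> C1_deriv_le (case_prod (b k)) (\<lambda>_. L)"
    and \<sigma>_C1: "k < N \<Longrightarrow> C1_deriv_le (case_prod (\<lambda>x u. \<sigma> k x u $ i)) (\<lambda>_. L)"
    and ell_C1: "k < N \<Longrightarrow> C1_deriv_le (case_prod (ell k)) (\<lambda>z. c * (1 + norm z))"
    and \<Phi>_C1: "C1_deriv_le \<Phi> (\<lambda>x. c * (1 + norm x))"

sublocale stochastic_control \<subseteq>
  adjoint_recursion M "filt M w" N "noise_weight w" x0 "noise_coefficient b \<sigma>" ell \<Phi> L c
proof
  have w: "w j \<in> borel_measurable M" if "j \<in> {1..N}" for j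
    using w_indep that by (auto simp: indep_vars_def2)
  show "subalgebra M (filt M w k)" if "k \<le> N" for k
    using that by (intro subalgebra_filt w) auto
  show "subalgebra (filt M w (Suc k)) (filt M w k)" for k
    by (rule subalgebra_filt_mono) simp
  fix k i assume k: "k < N"
  show "isometric_multiplier M (filt M w k) (noise_weight w k i)"
    using isometric_multiplier_noise[OF w_indep k w_square_integrable[OF k] w_variance[OF k]]
    by (cases i) (simp_all add: noise_weight_def[abs_def] isometric_multiplier_1)
  show "noise_weight w k i \<in> borel_measurable (filt M w (Suc k))"
    using measurable_compose[OF measurable_filt[of "Suc k" "Suc k" w M] borel_measurable_vec_nth]
    by (cases i) (simp_all add: noise_weight_def[abs_def])
  show "C1_deriv_le (case_prod (noise_coefficient b \<sigma> k i)) (\<lambda>_. L)"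
    using b_C1[OF k] \<sigma>_C1[OF k] by (cases i) (simp_all add: noise_coefficient_def[abs_def])
qed (fact ell_C1 \<Phi>_C1)+

context stochastic_control
begin

abbreviation adjoint_p :: "(nat \<Rightarrow> 'a \<Rightarrow> real^'m) \<Rightarrow> nat \<Rightarrow> 'a \<Rightarrow> real^'n" where
  "adjoint_p u k \<equiv> adjoint u k None"

definition adjoint_q :: "(nat \<Rightarrow> 'a \<Rightarrow> real^'m) \<Rightarrow> nat \<Rightarrow> 'a \<Rightarrow> real^'n^'d" where
  "adjoint_q u k \<omega> = (\<chi> i. adjoint u k (Some i) \<omega>)"

lemma adjoint_q_nth: "adjoint_q u k \<omega> $ i = adjoint u k (Some i) \<omega>"
  by (simp add: adjoint_q_def)

lemma L2_adjoint_q: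
  assumes "admissible u" "k < N"
  shows "L2 M (filt M w k) (adjoint_q u k)"
  by (rule L2_componentwise) (simp add: adjoint_q_nth L2_adjoint[OF assms])

lemma Ham_eq_hamiltonian:
  "Ham ell b \<sigma> k x (adjoint_p u k \<omega>) (adjoint_q u k \<omega>) v = hamiltonian k x (\<lambda>i. adjoint u k i \<omega>) v"
  by (simp add: Ham_def hamiltonian_def sum_UNIV_option noise_coefficient_def adjoint_q_nth)

lemma gradx_Ham_eq_hamiltonian_gradx:
  "gradx_Ham ell b \<sigma> k x (adjoint_p u k \<omega>) (adjoint_q u k \<omega>) v
    = hamiltonian_gradx k x (\<lambda>i. adjoint u k i \<omega>) v"
  by (simp add: gradx_Ham_def hamiltonian_gradx_def Ham_eq_hamiltonian)

lemma gradu_Ham_eq_hamiltonian_gradu: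
  "gradu_Ham ell b \<sigma> k x (adjoint_p u k \<omega>) (adjoint_q u k \<omega>) v
    = hamiltonian_gradu k x (\<lambda>i. adjoint u k i \<omega>) v"
  by (simp add: gradu_Ham_def hamiltonian_gradu_def Ham_eq_hamiltonian)

lemma trajectory_Suc:
  "trajectory u (Suc k) \<omega> = b k (trajectory u k \<omega>) (u k \<omega>)
    + (\<Sum>i\<in>UNIV. (w (Suc k) \<omega> $ i) *\<^sub>R (\<sigma> k (trajectory u k \<omega>) (u k \<omega>) $ i))"
  by (simp add: sum_UNIV_option noise_weight_def noise_coefficient_def)

lemma adm_iff_admissible: "adm M w N u \<longleftrightarrow> admissible u"
  by (simp add: adm_def admissible_def)

lemma ctrl_set_admissible: "ctrl_set M w N U \<Longrightarrow> u \<in> U \<Longrightarrow> admissible u"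
  unfolding adm_iff_admissible[symmetric] by (rule ctrl_set_adm)

lemma feasible_trajectory:
  assumes U: "ctrl_set M w N U" and u: "u \<in> U"
  shows "feasible M w N b \<sigma> x0 U (trajectory u) u"
proof -
  note adm = ctrl_set_admissible[OF U u]
  have "trajectory u k \<in> Xsp M w k" if k: "k \<le> N" for k
  proof (cases k)
    case 0
    then show ?thesis by (simp add: Xsp_def)
  next
    case (Suc l)
    with k have l: "l < N" by simp
    have "L2 M (filt M w l) (\<lambda>\<omega>. noise_coefficient b \<sigma> l i (trajectory u l \<omega>) (u l \<omega>))" for i
      using l by (intro L2_coefficient L2_trajectory[OF adm] admissible_L2(1)[OF adm]) auto
    from this[of None] this[of "Some _"]
    have coefficients: "L2 M (filt M w l) (\<lambda>\<omega>. b l (trajectory u l \<omega>) (u l \<omega>))"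
      "\<And>i. L2 M (filt M w l) (\<lambda>\<omega>. \<sigma> l (trajectory u l \<omega>) (u l \<omega>) $ i)"
      by (simp_all add: noise_coefficient_def)
    have "trajectory u (Suc l) \<in> borel_measurable M"
      using L2_measurable[OF L2_trajectory_M[OF adm k]] Suc by simp
    with coefficients show ?thesis
      unfolding Suc Xsp_def
      by (auto simp: trajectory_Suc simp del: trajectory.simps
          intro!: exI[of _ "\<lambda>\<omega>. b l (trajectory u l \<omega>) (u l \<omega>)"]
            exI[of _ "\<lambda>i \<omega>. \<sigma> l (trajectory u l \<omega>) (u l \<omega>) $ i"])
  qed
  with u show ?thesis
    by (simp add: feasible_def trajectory_Suc del: trajectory.simps(2))
qed

lemma feasible_AE_eq_trajectory:
  assumes feasible: "feasible M w N b \<sigma> x0 U x u"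
  shows "k \<le> N \<Longrightarrow> AE \<omega> in M. x k \<omega> = trajectory u k \<omega>"
proof (induction k)
  case 0
  show ?case using feasible by (simp add: feasible_def)
next
  case (Suc k)
  have "AE \<omega> in M. x (Suc k) \<omega> =
      b k (x k \<omega>) (u k \<omega>) + (\<Sum>i\<in>UNIV. (w (Suc k) \<omega> $ i) *\<^sub>R (\<sigma> k (x k \<omega>) (u k \<omega>) $ i))"
    using feasible Suc.prems by (auto simp: feasible_def)
  moreover have "AE \<omega> in M. x k \<omega> = trajectory u k \<omega>" using Suc by simp
  ultimately show ?case
    by eventually_elim (simp add: trajectory_Suc del: trajectory.simps)
qed

lemma feasible_AE_eq_trajectory_all:
  assumes "feasible M w N b \<sigma> x0 U x u"
  shows "AE \<omega> in M. \<forall>k\<in>{..N}. x k \<omega> = trajectory u k \<omega>"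
  using feasible_AE_eq_trajectory[OF assms] by (subst AE_ball_countable) auto

lemma L2_feasible:
  assumes "feasible M w N b \<sigma> x0 U x u" and "admissible u" and k: "k \<le> N"
  shows "L2 M M (x k)"
proof (rule L2_cong_AE)
  show "x k \<in> borel_measurable M" using assms by (simp add: feasible_def Xsp_def)
qed (use assms in \<open>auto intro: L2_trajectory_M feasible_AE_eq_trajectory\<close>)

lemma cost_feasible:
  assumes feasible: "feasible M w N b \<sigma> x0 U x u" and u: "admissible u"
  shows "cost M N ell \<Phi> x u = cost M N ell \<Phi> (trajectory u) u"
  unfolding cost_def
proof (rule integral_cong_AE)
  show "(\<lambda>\<omega>. (\<Sum>k<N. ell k (x k \<omega>) (u k \<omega>)) + \<Phi> (x N \<omega>)) \<in> borel_measurable M"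
    by (intro borel_measurable_integrable integrable_cost L2_feasible[OF feasible u]
        admissible_L2(2)[OF u])
  show "(\<lambda>\<omega>. (\<Sum>k<N. ell k (trajectory u k \<omega>) (u k \<omega>)) + \<Phi> (trajectory u N \<omega>)) \<in> borel_measurable M"
    by (intro borel_measurable_integrable integrable_cost L2_trajectory_M[OF u]
        admissible_L2(2)[OF u])
  show "AE \<omega> in M. (\<Sum>k<N. ell k (x k \<omega>) (u k \<omega>)) + \<Phi> (x N \<omega>)
      = (\<Sum>k<N. ell k (trajectory u k \<omega>) (u k \<omega>)) + \<Phi> (trajectory u N \<omega>)"
    using feasible_AE_eq_trajectory_all[OF feasible] by eventually_elim simp
qed

lemma adjoint_equation:
  assumes feasible: "feasible M w N b \<sigma> x0 U x u" and u: "admissible u" and k: "Suc k < N"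
  shows "AE \<omega> in M. adjoint u k i \<omega> = cond_exp_vec M (filt M w k) (\<lambda>\<omega>. noise_weight w k i \<omega> *\<^sub>R
    gradx_Ham ell b \<sigma> (Suc k) (x (Suc k) \<omega>) (adjoint_p u (Suc k) \<omega>) (adjoint_q u (Suc k) \<omega>)
        (u (Suc k) \<omega>)) \<omega>"
  unfolding gradx_Ham_eq_hamiltonian_gradx
proof (rule adjoint_cong_AE[OF u])
  show "k < N" using k by simp
  show "(\<lambda>\<omega>. hamiltonian_gradx (Suc k) (x (Suc k) \<omega>) (\<lambda>i. adjoint u (Suc k) i \<omega>) (u (Suc k) \<omega>))
      \<in> borel_measurable M"
    by (intro L2_measurable[of M] L2_hamiltonian_gradx k L2_feasible[OF feasible u]
        admissible_L2(2)[OF u]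
        L2_adjoint(2)[OF u] less_imp_le)
  show "AE \<omega> in M. costate u (Suc k) \<omega>
      = hamiltonian_gradx (Suc k) (x (Suc k) \<omega>) (\<lambda>i. adjoint u (Suc k) i \<omega>) (u (Suc k) \<omega>)"
    using feasible_AE_eq_trajectory[OF feasible less_imp_le[OF k]]
    by eventually_elim (simp add: costate_step[OF k])
qed

lemma adjoint_equation_terminal:
  assumes feasible: "feasible M w N b \<sigma> x0 U x u" and u: "admissible u" and k: "Suc k = N"
  shows "AE \<omega> in M. adjoint u k i \<omega>
    = cond_exp_vec M (filt M w k) (\<lambda>\<omega>. noise_weight w k i \<omega> *\<^sub>R grad \<Phi> (x N \<omega>)) \<omega>"
proof (rule adjoint_cong_AE[OF u])
  show "k < N" using k by simp
  show "(\<lambda>\<omega>. grad \<Phi> (x N \<omega>)) \<in> borel_measurable M"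
    by (intro L2_measurable[of M] L2_grad_terminal_cost L2_feasible[OF feasible u] order_refl)
  show "AE \<omega> in M. costate u (Suc k) \<omega> = grad \<Phi> (x N \<omega>)"
    using feasible_AE_eq_trajectory[OF feasible order_refl]
    by eventually_elim (simp add: k costate_terminal)
qed

lemma
  assumes feasible: "feasible M w N b \<sigma> x0 U x u" and u: "admissible u" and k: "k \<in> {1..N-1}"
  defines "gradx \<omega> \<equiv> gradx_Ham ell b \<sigma> k (x k \<omega>) (adjoint_p u k \<omega>) (adjoint_q u k \<omega>) (u k \<omega>)"
  shows adjoint_p_equation:
      "AE \<omega> in M. adjoint_p u (k-1) \<omega> = cond_exp_vec M (filt M w (k-1)) gradx \<omega>"
    and adjoint_q_equation: "AE \<omega> in M. adjoint_q u (k-1) \<omega> $ i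
      = cond_exp_vec M (filt M w (k-1)) (\<lambda>\<omega>. (w k \<omega> $ i) *\<^sub>R gradx \<omega>) \<omega>"
proof -
  have pos: "0 < k" and "Suc (k - 1) < N" using k by auto
  note equation = adjoint_equation[OF feasible u this(2),
      unfolded Suc_diff_1[OF pos], folded gradx_def]
  show "AE \<omega> in M. adjoint_p u (k-1) \<omega> = cond_exp_vec M (filt M w (k-1)) gradx \<omega>"
    using equation[of None] by (simp add: noise_weight_def)
  show "AE \<omega> in M. adjoint_q u (k-1) \<omega> $ i
      = cond_exp_vec M (filt M w (k-1)) (\<lambda>\<omega>. (w k \<omega> $ i) *\<^sub>R gradx \<omega>) \<omega>"
    using equation[of "Some i"] pos by (simp add: noise_weight_def adjoint_q_nth)
qed

lemma
  assumes feasible: "feasible M w N b \<sigma> x0 U x u" and u: "admissible u" and N: "N \<ge> 1"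
  shows adjoint_p_terminal:
      "AE \<omega> in M. adjoint_p u (N-1) \<omega> = cond_exp_vec M (filt M w (N-1)) (\<lambda>\<omega>. grad \<Phi> (x N \<omega>)) \<omega>"
    and adjoint_q_terminal:
      "AE \<omega> in M. adjoint_q u (N-1) \<omega> $ i
        = cond_exp_vec M (filt M w (N-1)) (\<lambda>\<omega>. (w N \<omega> $ i) *\<^sub>R grad \<Phi> (x N \<omega>)) \<omega>"
proof -
  have "Suc (N - 1) = N" using N by simp
  note equation = adjoint_equation_terminal[OF feasible u this]
  show "AE \<omega> in M. adjoint_p u (N-1) \<omega> = cond_exp_vec M (filt M w (N-1)) (\<lambda>\<omega>. grad \<Phi> (x N \<omega>)) \<omega>"
    using equation[of None] by (simp add: noise_weight_def)
  show "AE \<omega> in M. adjoint_q u (N-1) \<omega> $ i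
      = cond_exp_vec M (filt M w (N-1)) (\<lambda>\<omega>. (w N \<omega> $ i) *\<^sub>R grad \<Phi> (x N \<omega>)) \<omega>"
    using equation[of "Some i"] N by (simp add: noise_weight_def adjoint_q_nth)
qed

lemma cost_derivative_eq_integral_gradu_Ham:
  assumes feasible: "feasible M w N b \<sigma> x0 U x u" and u: "admissible u" and v: "admissible v"
  shows "cost_derivative u v = (\<integral>\<omega>. (\<Sum>k<N.
    gradu_Ham ell b \<sigma> k (x k \<omega>) (adjoint_p u k \<omega>) (adjoint_q u k \<omega>) (u k \<omega>) \<bullet> v k \<omega>) \<partial>M)"
  unfolding cost_derivative_eq_integral_cost_gradient[OF u v] gradu_Ham_eq_hamiltonian_gradu
proof (rule integral_cong_AE)
  show "(\<lambda>\<omega>. \<Sum>k<N. cost_gradient u k \<omega> \<bullet> v k \<omega>) \<in> borel_measurable M"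
    by (intro borel_measurable_sum borel_measurable_inner L2_measurable[of M] L2_cost_gradient[OF u]
        admissible_L2(2)[OF v]) simp_all
  show "(\<lambda>\<omega>. \<Sum>k<N. hamiltonian_gradu k (x k \<omega>) (\<lambda>i. adjoint u k i \<omega>) (u k \<omega>) \<bullet> v k \<omega>)
      \<in> borel_measurable M"
    by (intro borel_measurable_sum borel_measurable_inner L2_measurable[of M] L2_hamiltonian_gradu
        L2_feasible[OF feasible u] L2_adjoint(2)[OF u] admissible_L2(2)[OF u]
        admissible_L2(2)[OF v]) simp_all
  show "AE \<omega> in M. (\<Sum>k<N. cost_gradient u k \<omega> \<bullet> v k \<omega>)
      = (\<Sum>k<N. hamiltonian_gradu k (x k \<omega>) (\<lambda>i. adjoint u k i \<omega>) (u k \<omega>) \<bullet> v k \<omega>)"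
    using feasible_AE_eq_trajectory_all[OF feasible]
    by eventually_elim (simp add: cost_gradient_def)
qed

lemma local_solution_feasible:
  assumes "ctrl_set M w N U" and "local_solution M w N b \<sigma> ell \<Phi> x0 U x u"
  shows "feasible M w N b \<sigma> x0 U x u" "u \<in> U" "admissible u"
  using assms ctrl_set_admissible by (auto simp: local_solution_def feasible_def)

definition solution_dist :: "(nat \<Rightarrow> 'a \<Rightarrow> real^'m) \<Rightarrow> (nat \<Rightarrow> 'a \<Rightarrow> real^'m) \<Rightarrow> real" where
  "solution_dist u' u =
     (\<Sum>k\<le>N. L2norm M (\<lambda>\<omega>. trajectory u' k \<omega> - trajectory u k \<omega>)) + cdist M N u' u"

lemma local_solution_minimizes_over_controls:
  assumes U: "ctrl_set M w N U" and loc: "local_solution M w N b \<sigma> ell \<Phi> x0 U x u"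
  obtains r where "0 < r" "\<And>u'. u' \<in> U \<Longrightarrow> solution_dist u' u < r \<Longrightarrow>
    cost M N ell \<Phi> (trajectory u) u \<le> cost M N ell \<Phi> (trajectory u') u'"
proof -
  note feasible = local_solution_feasible(1)[OF U loc] and u = local_solution_feasible(3)[OF U loc]
  obtain r where r_pos: "0 < r" and minimal: "\<And>x' u'. feasible M w N b \<sigma> x0 U x' u' \<Longrightarrow>
      (\<Sum>k\<le>N. L2norm M (\<lambda>\<omega>. x' k \<omega> - x k \<omega>)) + cdist M N u' u < r \<Longrightarrow>
      cost M N ell \<Phi> x u \<le> cost M N ell \<Phi> x' u'"
    using loc unfolding local_solution_def by blast
  have "cost M N ell \<Phi> (trajectory u) u \<le> cost M N ell \<Phi> (trajectory u') u'"
    if u': "u' \<in> U" and near: "solution_dist u' u < r" for u'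
  proof -
    have "L2norm M (\<lambda>\<omega>. trajectory u' k \<omega> - x k \<omega>)
        = L2norm M (\<lambda>\<omega>. trajectory u' k \<omega> - trajectory u k \<omega>)"
      if k: "k \<le> N" for k
    proof (rule L2norm_cong_AE)
      have "L2 M M (trajectory u' k)" "L2 M M (x k)" "L2 M M (trajectory u k)"
        using L2_trajectory_M L2_feasible[OF feasible u] ctrl_set_admissible[OF U u'] u k by auto
      from this[THEN L2_measurable]
      show "(\<lambda>\<omega>. trajectory u' k \<omega> - x k \<omega>) \<in> borel_measurable M"
        "(\<lambda>\<omega>. trajectory u' k \<omega> - trajectory u k \<omega>) \<in> borel_measurable M" by simp_all
    qed (use feasible_AE_eq_trajectory[OF feasible k] in auto)
    with near have "cost M N ell \<Phi> x u \<le> cost M N ell \<Phi> (trajectory u') u'"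
      by (intro minimal feasible_trajectory[OF U u']) (simp add: solution_dist_def)
    then show ?thesis by (simp add: cost_feasible[OF feasible u])
  qed
  with r_pos show thesis by (rule that)
qed

lemma solution_dist_tendsto_0:
  assumes t: "step_sizes t"
    and tangent: "\<And>k. k < N \<Longrightarrow> L2_tangent M (filt M w k) t (\<lambda>j. us j k) (u k) (v k)"
  shows "(\<lambda>j. solution_dist (us j) u) \<longlonglongrightarrow> 0"
proof -
  have "(\<lambda>j. L2norm M (\<lambda>\<omega>. trajectory (us j) k \<omega> - trajectory u k \<omega>)) \<longlonglongrightarrow> 0" if "k \<in> {..N}" for k
    using that
    by (intro L2_tendstoD(3)[OF
          L2_tangent_tendsto[OF subalg t trajectory_tangent[OF t tangent]]]) auto
  moreover have "(\<lambda>j. L2norm M (\<lambda>\<omega>. us j k \<omega> - u k \<omega>)) \<longlonglongrightarrow> 0" if "k \<in> {..<N}" for k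
    using that by (intro L2_tendstoD(3)[OF L2_tangent_tendsto[OF subalg t tangent]]) auto
  ultimately have "(\<lambda>j. solution_dist (us j) u) \<longlonglongrightarrow> (\<Sum>k\<le>N. 0) + (\<Sum>k<N. 0)"
    unfolding solution_dist_def cdist_def by (intro tendsto_add tendsto_sum)
  then show ?thesis by simp
qed

lemma cost_derivative_nonneg:
  assumes U: "ctrl_set M w N U" and loc: "local_solution M w N b \<sigma> ell \<Phi> x0 U x u"
    and v: "v \<in> contingent_cone M w N U u"
  shows "0 \<le> cost_derivative u v"
proof -
  obtain r where r_pos: "0 < r" and minimal: "\<And>u'. u' \<in> U \<Longrightarrow> solution_dist u' u < r \<Longrightarrow>
      cost M N ell \<Phi> (trajectory u) u \<le> cost M N ell \<Phi> (trajectory u') u'"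
    using local_solution_minimizes_over_controls[OF U loc] by blast
  obtain t us where t: "step_sizes t" and us: "\<And>j. us j \<in> U"
    and tangent: "\<And>k. k < N \<Longrightarrow> L2_tangent M (filt M w k) t (\<lambda>j. us j k) (u k) (v k)"
    using contingent_cone_tangent_sequence[OF subalg[OF less_imp_le] U
        local_solution_feasible(2)[OF U loc] v]
    by blast
  have "\<forall>\<^sub>F j in sequentially. solution_dist (us j) u < r"
    using solution_dist_tendsto_0[OF t tangent] r_pos by (rule order_tendstoD(2))
  then have eventually_le: "\<forall>\<^sub>F j in sequentially.
      cost M N ell \<Phi> (trajectory u) u \<le> cost M N ell \<Phi> (trajectory (us j)) (us j)"
    by eventually_elim (rule minimal[OF us])
  show ?thesis by (rule cost_derivative_nonneg_if_minimal[OF t tangent eventually_le])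
qed

lemma variational_inequality:
  assumes U: "ctrl_set M w N U" and loc: "local_solution M w N b \<sigma> ell \<Phi> x0 U x u"
    and v: "v \<in> contingent_cone M w N U u"
  shows "0 \<le> (\<integral>\<omega>. (\<Sum>k<N.
    gradu_Ham ell b \<sigma> k (x k \<omega>) (adjoint_p u k \<omega>) (adjoint_q u k \<omega>) (u k \<omega>) \<bullet> v k \<omega>) \<partial>M)"
proof -
  note u = local_solution_feasible[OF U loc]
  have "admissible v" using v by (simp add: contingent_cone_def adm_iff_admissible)
  with cost_derivative_nonneg[OF U loc v] show ?thesis
    by (simp add: cost_derivative_eq_integral_gradu_Ham[OF u(1,3)])
qed

end

theorem theorem6p4:
  fixes M :: "'a measure"
    and w :: "nat \<Rightarrow> 'a \<Rightarrow> real^'d::finite"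
    and N :: nat
    and x0 :: "real^'n::finite"
    and b :: "nat \<Rightarrow> real^'n \<Rightarrow> real^'m::finite \<Rightarrow> real^'n"
    and \<sigma> :: "nat \<Rightarrow> real^'n \<Rightarrow> real^'m \<Rightarrow> real^'n^'d"
    and ell :: "nat \<Rightarrow> real^'n \<Rightarrow> real^'m \<Rightarrow> real"
    and \<Phi> :: "real^'n \<Rightarrow> real"
    and U :: "(nat \<Rightarrow> 'a \<Rightarrow> real^'m) set"
    and xb :: "nat \<Rightarrow> 'a \<Rightarrow> real^'n"
    and ub :: "nat \<Rightarrow> 'a \<Rightarrow> real^'m"
  assumes P: "prob_space M"
    and N: "N \<ge> 1"
    and w_indep: "prob_space.indep_vars M (\<lambda>_. borel) w {1..N}"
    and w_coord_indep: "\<forall>k\<in>{1..N}. prob_space.indep_vars M (\<lambda>_. borel) (\<lambda>i \<omega>. w k \<omega> $ i) UNIV"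
    and w_mean: "\<forall>k\<in>{1..N}. \<forall>i. integrable M (\<lambda>\<omega>. w k \<omega> $ i) \<and> (\<integral>\<omega>. w k \<omega> $ i \<partial>M) = 0"
    and w_var: "\<forall>k\<in>{1..N}. \<forall>i. integrable M (\<lambda>\<omega>. (w k \<omega> $ i)\<^sup>2) \<and> (\<integral>\<omega>. (w k \<omega> $ i)\<^sup>2 \<partial>M) = 1"
    and b_meas: "\<forall>k<N. (\<lambda>z. b k (fst z) (snd z)) \<in> borel_measurable borel"
    and \<sigma>_meas: "\<forall>k<N. \<forall>i. (\<lambda>z. \<sigma> k (fst z) (snd z) $ i) \<in> borel_measurable borel"
    and ell_meas: "\<forall>k<N. (\<lambda>z. ell k (fst z) (snd z)) \<in> borel_measurable borel"
    and \<Phi>_meas: "\<Phi> \<in> borel_measurable borel"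
    and b_C1: "\<forall>k<N. C1_map (\<lambda>z. b k (fst z) (snd z))"
    and \<sigma>_C1: "\<forall>k<N. \<forall>i. C1_map (\<lambda>z. \<sigma> k (fst z) (snd z) $ i)"
    and ell_C1: "\<forall>k<N. C1_map (\<lambda>z. ell k (fst z) (snd z))"
    and \<Phi>_C1: "C1_map \<Phi>"
    and c1: "c1 > 0" and c2: "(c2::real) > 0"
    and b_growth: "\<forall>k<N. \<forall>x u. norm (b k x u) \<le> c1 * (1 + norm x + norm u)
                     \<and> onorm (Dx (b k) x u) + onorm (Du (b k) x u) \<le> c1"
    and \<sigma>_growth: "\<forall>k<N. \<forall>i x u. norm (\<sigma> k x u $ i) \<le> c1 * (1 + norm x + norm u)
                     \<and> onorm (Dx (\<lambda>x u. \<sigma> k x u $ i) x u) + onorm (Du (\<lambda>x u. \<sigma> k x u $ i) x u) \<le> c1"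
    and ell_growth: "\<forall>k<N. \<forall>x u. \<bar>ell k x u\<bar> \<le> c2 * (1 + norm x + norm u)\<^sup>2
                     \<and> onorm (Dx (ell k) x u) + onorm (Du (ell k) x u) \<le> c2 * (1 + norm x + norm u)"
    and \<Phi>_growth: "\<forall>x. \<bar>\<Phi> x\<bar> \<le> c2 * (1 + norm x)\<^sup>2
                     \<and> onorm (frechet_derivative \<Phi> (at x)) \<le> c2 * (1 + norm x)"
    and U_set: "ctrl_set M w N U"
    and U_ne: "U \<noteq> {}"
    and U_closed: "closed_ctrl M w N U"
    and loc: "local_solution M w N b \<sigma> ell \<Phi> x0 U xb ub"
  shows "\<exists>p :: nat \<Rightarrow> 'a \<Rightarrow> real^'n. \<exists>q :: nat \<Rightarrow> 'a \<Rightarrow> real^'n^'d.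
     (\<forall>k<N. L2 M (filt M w k) (p k) \<and> L2 M (filt M w k) (q k)) \<and>
     (\<forall>k\<in>{1..N-1}.
        (AE \<omega> in M. p (k-1) \<omega> = cond_exp_vec M (filt M w (k-1))
            (\<lambda>\<omega>'. gradx_Ham ell b \<sigma> k (xb k \<omega>') (p k \<omega>') (q k \<omega>') (ub k \<omega>')) \<omega>) \<and>
        (\<forall>i. AE \<omega> in M. q (k-1) \<omega> $ i = cond_exp_vec M (filt M w (k-1))
            (\<lambda>\<omega>'. (w k \<omega>' $ i) *\<^sub>R gradx_Ham ell b \<sigma> k (xb k \<omega>') (p k \<omega>') (q k \<omega>') (ub k \<omega>')) \<omega>)) \<and>
     (AE \<omega> in M. p (N-1) \<omega> = cond_exp_vec M (filt M w (N-1)) (\<lambda>\<omega>'. grad \<Phi> (xb N \<omega>')) \<omega>) \<and>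
     (\<forall>i. AE \<omega> in M. q (N-1) \<omega> $ i = cond_exp_vec M (filt M w (N-1))
            (\<lambda>\<omega>'. (w N \<omega>' $ i) *\<^sub>R grad \<Phi> (xb N \<omega>')) \<omega>) \<and>
     (\<forall>v\<in>clarke_cone M w N U ub.
        (\<integral>\<omega>. (\<Sum>k<N. gradu_Ham ell b \<sigma> k (xb k \<omega>) (p k \<omega>) (q k \<omega>) (ub k \<omega>) \<bullet> v k \<omega>) \<partial>M) \<ge> 0) \<and>
     (convex_ctrl (contingent_cone M w N U ub) \<longrightarrow>
        (\<forall>v\<in>contingent_cone M w N U ub.
        (\<integral>\<omega>. (\<Sum>k<N. gradu_Ham ell b \<sigma> k (xb k \<omega>) (p k \<omega>) (q k \<omega>) (ub k \<omega>) \<bullet> v k \<omega>) \<partial>M) \<ge> 0))"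
proof -
  interpret prob_space M by (rule P)
  interpret stochastic_control M w N x0 b \<sigma> ell \<Phi> c1 "2 * c2"
  proof
    show "C1_deriv_le (case_prod (b k)) (\<lambda>_. c1)" if "k < N" for k
      using b_C1 b_growth that by (intro C1_deriv_le_case_prod) auto
    show "C1_deriv_le (case_prod (\<lambda>x u. \<sigma> k x u $ i)) (\<lambda>_. c1)" if "k < N" for k i
      using \<sigma>_C1 \<sigma>_growth that by (intro C1_deriv_le_case_prod) auto
    show "C1_deriv_le (case_prod (ell k)) (\<lambda>z. 2 * c2 * (1 + norm z))" if "k < N" for k
      using ell_C1 ell_growth c2 that by (intro C1_deriv_le_case_prod_linear_growth) auto
    have "C1_deriv_le \<Phi> (\<lambda>x. c2 * (1 + norm x))" using \<Phi>_C1 \<Phi>_growth by (simp add: C1_deriv_le_def)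
    then show "C1_deriv_le \<Phi> (\<lambda>x. 2 * c2 * (1 + norm x))"
      by (rule C1_deriv_le_mono) (use c2 in simp)
  qed (use w_indep w_var in auto)
  note ub = local_solution_feasible[OF U_set loc]
  note clarke = subsetD[OF clarke_cone_subset_contingent_cone[OF ub(2)]]
  show ?thesis
    by (intro exI[of _ "adjoint_p ub"] exI[of _ "adjoint_q ub"] conjI ballI allI impI)
      (rule L2_adjoint(1)[OF ub(3)] L2_adjoint_q[OF ub(3)]
        adjoint_p_equation[OF ub(1,3)] adjoint_q_equation[OF ub(1,3)]
        adjoint_p_terminal[OF ub(1,3) N] adjoint_q_terminal[OF ub(1,3) N]
        variational_inequality[OF U_set loc clarke] variational_inequality[OF U_set loc],
        assumption?)+
qed

end
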